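(* Let $n\geq 3$ be an integer, let $\nu>2$ be a real number, and let $\psi_\nu:\mathbb N\to(0,1]$ be given by $\psi_\nu(q)=q^{-\nu}$. If $\mathcal H^{2/\nu}(E(1,\psi_\nu))>0$, then $\mathcal H^{(n+1)/\nu}(E(n,\psi_\nu))=\infty$.
   Context: Here $\mathbb N$ denotes the positive integers and $\mathcal H^s$ denotes the $s$-dimensional Hausdorff measure. For an integer $n\geq 1$ and a function $\psi:\mathbb N\to(0,1]$, define $$W(n,\psi):=\left\{\boldsymbol\alpha\in[0,1]^n:\ \max_{1\leq i\leq n}\left|\alpha_i-\frac{p_i}{q}\right|<\psi(q)\ \text{for infinitely many } q\in\mathbb N,\ \boldsymbol p\in\mathbb Z^n\right\}$$ and $$E(n,\psi):=W(n,\psi)\setminus\bigcup_{0<c<1}W(n,c\psi).$$ *)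

theory Defs
  imports "HOL-Analysis.Analysis"
begin

(* The weight of a covering set in the definition of the s-dimensional Hausdorff measure,
   with the usual conventions that the empty set has weight 0 and that 0^0 = 1
   (so that the 0-dimensional measure is the counting measure); note that powr has 0 powr 0 = 0. *)
definition diam_weight :: "real \<Rightarrow> 'a::metric_space set \<Rightarrow> ennreal" where
  "diam_weight s U = (if U = {} then 0 else if s = 0 then 1 else ennreal (diameter U powr s))"

(* Boundedness is required explicitly because diameter is unspecified on unbounded sets. *)
definition hausdorff_content :: "real \<Rightarrow> real \<Rightarrow> 'a::metric_space set \<Rightarrow> ennreal" where
  "hausdorff_content s \<delta> A =
     (INF U \<in> {U :: nat \<Rightarrow> 'a set. A \<subseteq> (\<Union>i. U i) \<and> (\<forall>i. bounded (U i) \<and> diameter (U i) \<le> \<delta>)}.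
        \<Sum>i. diam_weight s (U i))"

(* The (unnormalised) Hausdorff outer measure, defined on all subsets. *)
definition hausdorff_measure :: "real \<Rightarrow> 'a::metric_space set \<Rightarrow> ennreal" where
  "hausdorff_measure s A = (SUP \<delta> \<in> {0<..}. hausdorff_content s \<delta> A)"

(* The dimension n is CARD('n). The positive integers are encoded as nat with the guard q > 0;
   the value of \<psi> at 0 is irrelevant. *)
definition W :: "(nat \<Rightarrow> real) \<Rightarrow> (real ^ 'n) set" where
  "W \<psi> = {\<alpha>. (\<forall>i. 0 \<le> \<alpha> $ i \<and> \<alpha> $ i \<le> 1) \<and>
             infinite {(q :: nat, p :: int ^ 'n). q > 0 \<and>
               (MAX i. \<bar>\<alpha> $ i - of_int (p $ i) / of_nat q\<bar>) < \<psi> q}}"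

definition E :: "(nat \<Rightarrow> real) \<Rightarrow> (real ^ 'n) set" where
  "E \<psi> = W \<psi> - (\<Union>c \<in> {0<..<1}. W (\<lambda>q. c * \<psi> q))"

definition psi_pow :: "real \<Rightarrow> nat \<Rightarrow> real" where
  "psi_pow \<nu> q = real q powr (- \<nu>)"

end

theory Submission
  imports Defs
begin

text \<open>
  Fix one coordinate and split a point of \<open>[0,1]^n\<close> into \<open>(x, y)\<close> with \<open>x\<close> real and \<open>y\<close> of
  dimension \<open>m = n - 1\<close>. Let \<open>x\<close> lie in the one-dimensional exact order set, and let \<open>Q\<close> be the
  infinite set of denominators \<open>q\<close> for which some \<open>p / q\<close> is within \<open>q powr (- \<nu>)\<close> of \<open>x\<close>. If \<open>y\<close> is
  within \<open>q powr (- \<nu>)\<close> of a rational point of denominator \<open>q\<close> for infinitely many \<open>q\<close> in \<open>Q\<close>, then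
  \<open>(x, y)\<close> is \<open>\<psi>\<close>-approximable; and it is not \<open>c\<psi>\<close>-approximable for any \<open>c < 1\<close>, because \<open>x\<close>
  is not. So the \<open>n\<close>-dimensional exact order set contains, above every such \<open>x\<close>, a limsup set \<open>F(Q)\<close>
  of balls around rational points (\<open>fibre_in_E\<close>). It remains to see that \<open>F(Q)\<close> has infinite
  \<open>t\<close>-dimensional measure for \<open>t = m / \<nu>\<close>, and that the dimensions \<open>s = 2 / \<nu>\<close> of the base and \<open>t\<close>
  of the fibres add up to \<open>(n + 1) / \<nu>\<close>.

  The fibres. A covering of \<open>F(Q)\<close> by boxes of small radii \<open>e i\<close> has a large sum of \<open>e i powr t\<close>,
  uniformly in \<open>Q\<close> (\<open>fibre_cover\<close>). This is the mass transference principle for these balls, in the form of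
  a lower bound for coverings. A point of \<open>F(Q)\<close> outside the boxes is found as the intersection of
  nested cubes of radius \<open>q powr (- \<nu>) / 2\<close> around rational points. The invariant is that the boxes
  meeting the current cube of radius \<open>r\<close> have weight at most \<open>\<epsilon> * r powr t\<close>. It is kept by
  averaging over the rational points of one large denominator: boxes that are large compared with
  \<open>1 / q\<close> spoil few of these points because \<open>t < m\<close>, and the small boxes form a tail of a convergent
  series, as \<open>q\<close> may be chosen after the covering (\<open>lighter_subcube\<close>). The first cube comes from a grid;
  its side tends to 0 as the bound on the weight tends to infinity.

  The slicing. A covering of the exact order set by balls of radii \<open>e i\<close> projects to intervals on the
  line. By the previous step, the intervals around any \<open>x\<close> in the base have large total weight when
  interval \<open>i\<close> has weight \<open>e i powr t\<close>. A weighted covering of a subset of the line can be turned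
  into an ordinary one at bounded cost, by stopping along each branch of the dyadic tree when the weight
  collected exceeds a random threshold (\<open>weighted_cover_content\<close>). Hence finite
  \<open>(s + t)\<close>-dimensional measure of the exact order set in dimension \<open>n\<close> would force the
  \<open>s\<close>-dimensional measure of the base to vanish.
\<close>

section \<open>Integer points in cubes and averaging\<close>

lemma int_interval_eq:
  fixes c \<rho> :: real
  shows "{j::int. \<bar>real_of_int j - c\<bar> \<le> \<rho>} = {\<lceil>c - \<rho>\<rceil>..\<lfloor>c + \<rho>\<rfloor>}"
  by (auto simp: ceiling_le_iff le_floor_iff abs_le_iff)

definition lattice_cube :: "'k set \<Rightarrow> ('k \<Rightarrow> real) \<Rightarrow> real \<Rightarrow> ('k \<Rightarrow> int) set" where
  "lattice_cube I c \<rho> = (\<Pi>\<^sub>E k\<in>I. {j. \<bar>real_of_int j - c k\<bar> \<le> \<rho>})"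

lemma finite_lattice_cube: "finite I \<Longrightarrow> finite (lattice_cube I c \<rho>)"
  unfolding lattice_cube_def int_interval_eq by (intro finite_PiE) auto

lemma card_lattice_cube_le:
  assumes "finite I" "\<rho> \<ge> 0"
  shows "real (card (lattice_cube I c \<rho>)) \<le> (2 * \<rho> + 1) ^ card I"
proof -
  have "real (card {j::int. \<bar>real_of_int j - c k\<bar> \<le> \<rho>}) \<le> 2 * \<rho> + 1" for k
    unfolding int_interval_eq using assms(2) by simp linarith
  then have "(\<Prod>k\<in>I. real (card {j::int. \<bar>real_of_int j - c k\<bar> \<le> \<rho>})) \<le> (\<Prod>k\<in>I. 2 * \<rho> + 1)"
    by (intro prod_mono) auto
  then show ?thesis
    unfolding lattice_cube_def card_PiE[OF assms(1)] by simp
qed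

lemma card_lattice_cube_ge:
  assumes "finite I" "2 * \<rho> \<ge> 1"
  shows "(2 * \<rho> - 1) ^ card I \<le> real (card (lattice_cube I c \<rho>))"
proof -
  have "2 * \<rho> - 1 \<le> real (card {j::int. \<bar>real_of_int j - c k\<bar> \<le> \<rho>})" for k
    unfolding int_interval_eq using assms(2) by simp linarith
  then have "(\<Prod>k\<in>I. 2 * \<rho> - 1) \<le> (\<Prod>k\<in>I. real (card {j::int. \<bar>real_of_int j - c k\<bar> \<le> \<rho>}))"
    using assms(2) by (intro prod_mono) auto
  then show ?thesis
    unfolding lattice_cube_def card_PiE[OF assms(1)] by simp
qed

text \<open>
  With \<open>hit i p\<close> meaning that object \<open>i\<close> obstructs the candidate \<open>p\<close>, some candidate is
  obstructed by at most the average weight.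
\<close>

lemma averaging:
  fixes w b :: "nat \<Rightarrow> real" and hit :: "nat \<Rightarrow> 'p \<Rightarrow> bool"
  assumes P: "finite P" "P \<noteq> {}" and w: "\<And>i. 0 \<le> w i"
    and bound: "\<And>i. w i * real (card {p \<in> P. hit i p}) \<le> b i"
    and b: "summable b" "suminf b \<le> real (card P) * \<kappa>"
  obtains p where "p \<in> P" "summable (\<lambda>i. if hit i p then w i else 0)"
    "(\<Sum>i. if hit i p then w i else 0) \<le> \<kappa>"
proof -
  define f where "f p i = (if hit i p then w i else 0)" for p i
  have sum_f: "(\<Sum>p\<in>P. f p i) = w i * real (card {p \<in> P. hit i p})" for i
  proof -
    have "(\<Sum>p\<in>P. f p i) = (\<Sum>p\<in>{p \<in> P. hit i p}. w i)"
      unfolding f_def using P(1) by (subst sum.inter_filter) auto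
    then show ?thesis by simp
  qed
  have nonneg: "0 \<le> f p i" for p i
    using w by (simp add: f_def)
  have summ: "summable (f p)" if "p \<in> P" for p
  proof (rule summable_comparison_test'[OF b(1)])
    fix i
    have "f p i \<le> (\<Sum>p\<in>P. f p i)"
      using that P(1) nonneg by (intro member_le_sum) auto
    then show "norm (f p i) \<le> b i"
      using bound[of i] nonneg[of p i] unfolding sum_f by simp
  qed
  have "(\<Sum>p\<in>P. suminf (f p)) = (\<Sum>i. \<Sum>p\<in>P. f p i)"
    using summ by (subst suminf_sum) auto
  also have "\<dots> \<le> suminf b"
    using bound summ b(1) by (intro suminf_le summable_sum) (auto simp: sum_f)
  finally have total: "(\<Sum>p\<in>P. suminf (f p)) \<le> real (card P) * \<kappa>"
    using b(2) by linarith
  have "\<exists>p\<in>P. suminf (f p) \<le> \<kappa>"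
  proof (rule ccontr)
    assume "\<not> ?thesis"
    then have "(\<Sum>p\<in>P. \<kappa>) < (\<Sum>p\<in>P. suminf (f p))"
      using P by (intro sum_strict_mono) auto
    then show False using total by simp
  qed
  then show ?thesis
    using that summ unfolding f_def by blast
qed

section \<open>Limsup sets that escape a light family of boxes\<close>

text \<open>
  The boxes are the sets of all \<open>y\<close> with \<open>\<bar>y k - a i k\<bar> \<le> e i\<close> for \<open>k\<close> in \<open>I\<close>, where \<open>i\<close> ranges over \<open>T\<close>;
  the denominators available for approximation form \<open>Q\<close>. Points are functions on an arbitrary
  finite index set, so that the fibres of a space can be treated without naming their dimension
  by a type.
\<close>

locale boxes =
  fixes I :: "'k set" and T :: "nat set" and a :: "nat \<Rightarrow> 'k \<Rightarrow> real" and e :: "nat \<Rightarrow> real"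
    and \<nu> :: real and Q :: "nat set"
  assumes fin: "finite I" and ne: "I \<noteq> {}" and nu: "\<nu> > 1"
    and e_pos: "\<And>i. e i > 0" and inf_Q: "infinite Q"
    and summable_T: "summable (\<lambda>i. if i \<in> T then e i powr (real (card I) / \<nu>) else 0)"
begin

abbreviation "m \<equiv> card I"
abbreviation "t \<equiv> real m / \<nu>"
text \<open>The inequalities say that box \<open>i\<close> intersects the closed cube of radius \<open>r\<close> around \<open>z\<close>.\<close>

definition "hit z r i \<longleftrightarrow> i \<in> T \<and> (\<forall>k\<in>I. \<bar>a i k - z k\<bar> \<le> e i + r)"
definition "load z r = (\<Sum>i. if hit z r i then e i powr t else 0)"
text \<open>
  Small enough for the averaging: a box of radius \<open>e \<ge> 1 / q\<close> meets at most
  \<open>(4 * q * e) ^ m\<close> cubes, against at least \<open>(q * r / 2) ^ m\<close> candidates.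
\<close>

definition \<epsilon> :: real where "\<epsilon> = 1 / (8 * 8 ^ m)"
text \<open>Half of the approximation radius: closed cubes then stay inside the open condition.\<close>

definition rad :: "nat \<Rightarrow> real" where "rad q = real q powr (- \<nu>) / 2"

lemma m_pos: "0 < m" using fin ne by (simp add: card_gt_0_iff)
lemma t_pos: "0 < t" using m_pos nu by simp
lemma t_less: "t < real m" using m_pos nu by (simp add: divide_less_eq)
lemma eps: "0 < \<epsilon>" "\<epsilon> \<le> 1"
proof -
  have "(1::real) \<le> 8 ^ m" by simp
  then have "(1::real) \<le> 8 * 8 ^ m" by linarith
  then show "0 < \<epsilon>" "\<epsilon> \<le> 1" unfolding \<epsilon>_def by auto
qed

lemma summable_hit: "summable (\<lambda>i. if hit z r i then e i powr t else 0)"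
  by (rule summable_comparison_test'[OF summable_T]) (auto simp: hit_def)

lemma hit_weight_le: "hit z r i \<Longrightarrow> e i powr t \<le> load z r"
  using sum_le_suminf[OF summable_hit, of "{i}" z r] unfolding load_def by simp

text \<open>
  The invariant of the nested construction passes to some cube around a rational point of a large
  denominator \<open>q\<close>, by averaging over the points \<open>p / q\<close> in the cube. Capping each weight
  at \<open>2 * \<kappa>\<close>, where \<open>\<kappa>\<close> is the admissible load, makes one averaging argument serve both for
  large boxes (which must be avoided altogether, and have small total volume) and for small
  ones (each of which meets boundedly many of the new cubes): a load at most \<open>\<kappa>\<close> in capped weights
  shows that no weight was capped.
\<close>

lemma lighter_subcube:
  assumes r: "0 < r" and ld: "load z r \<le> \<epsilon> * r powr t"
  shows "\<exists>q p. q \<in> Q \<and> q > q0 \<and> (\<forall>k\<in>I. \<bar>real_of_int (p k) / real q - z k\<bar> + rad q \<le> r) \<and>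
    2 * rad q \<le> r \<and> load (\<lambda>k. real_of_int (p k) / real q) (rad q) \<le> \<epsilon> * rad q powr t"
proof -
  define w where "w i = e i powr t" for i
  define \<tau> where "\<tau> = \<epsilon> * 2 powr (-t) * r ^ m / (4 * 8 ^ m)"
  have "\<tau> > 0" using eps r by (simp add: \<tau>_def)
  obtain N where N: "\<And>n. n \<ge> N \<Longrightarrow> norm (\<Sum>i. (\<lambda>i. if i \<in> T then w i else 0) (i + n)) < \<tau>"
    using suminf_exist_split[OF \<open>\<tau> > 0\<close> summable_T] unfolding w_def by blast
  define B where "B = Max ({real q0, 2 / r} \<union> (\<lambda>i. 1 / e i) ` {..<N})"
  have "infinite (Q - {..nat \<lceil>B\<rceil>})"
    using inf_Q by (intro Diff_infinite_finite) auto
  then obtain q where q: "q \<in> Q" "q > nat \<lceil>B\<rceil>"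
    by (metis Diff_iff atMost_iff infinite_imp_nonempty equals0I not_le)
  have qB: "real q > B" using q(2) by linarith
  have B_ge: "x \<le> B" if "x \<in> {real q0, 2 / r} \<union> (\<lambda>i. 1 / e i) ` {..<N}" for x
    unfolding B_def using that by (intro Max_ge) auto
  have q_gt: "q > q0" using B_ge[of "real q0"] qB by simp
  have qr: "real q * r \<ge> 2"
  proof -
    have "2 / r \<le> real q" using B_ge[of "2 / r"] qB by auto
    then show ?thesis using r by (simp add: field_simps)
  qed
  have qe: "real q * e i \<ge> 1" if "i < N" for i
  proof -
    have "1 / e i \<le> real q" using B_ge[of "1 / e i"] that qB by auto
    then show ?thesis using e_pos[of i] by (simp add: field_simps)
  qed
  have q1: "real q \<ge> 1" using q_gt by simp
  \<comment> \<open>The new cubes are narrower than the spacing \<open>1 / q\<close>; this is where \<open>\<nu> \<ge> 1\<close> enters.\<close>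
  have rad_q: "2 * (real q * rad q) \<le> 1"
  proof -
    have "2 * (real q * rad q) = real q powr (1 - \<nu>)"
      using q1 by (simp add: rad_def powr_mult_base)
    also have "\<dots> \<le> real q powr 0" using q1 nu by (intro powr_mono) auto
    finally show ?thesis using q1 by simp
  qed
  have rad_pos: "rad q > 0" using q1 by (simp add: rad_def)
  have rad_r: "4 * rad q \<le> r"
  proof -
    have "real q * (4 * rad q) \<le> real q * r" using rad_q qr by linarith
    then show ?thesis using q1 by (subst (asm) mult_le_cancel_left_pos) auto
  qed
  define \<kappa> where "\<kappa> = \<epsilon> * rad q powr t"
  have rad_t: "rad q powr t = 2 powr (-t) * real q powr (- real m)"
  proof -
    have "rad q = 2 powr (-1) * real q powr (- \<nu>)" by (simp add: rad_def powr_minus)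
    then have "rad q powr t = (2 powr (-1)) powr t * (real q powr (- \<nu>)) powr t"
      by (simp only: powr_mult)
    then show ?thesis using nu by (simp only: powr_powr) (simp add: powr_powr)
  qed
  \<comment> \<open>The exponent is critical: with \<open>t = m / \<nu>\<close>, about \<open>q ^ m\<close> cubes of admissible load \<open>\<kappa>\<close>
    have a total that does not depend on \<open>q\<close>.\<close>
  have kq: "\<kappa> * real q ^ m = \<epsilon> * 2 powr (-t)"
    using q1 by (simp add: \<kappa>_def rad_t powr_minus powr_realpow)
  have k_pos: "\<kappa> > 0" using eps rad_pos by (simp add: \<kappa>_def)
  define P where "P = lattice_cube I (\<lambda>k. real q * z k) (real q * r / 2)"
  have P_fin: "finite P" unfolding P_def by (rule finite_lattice_cube[OF fin])
  have cardP: "(real q * r / 2) ^ m \<le> real (card P)"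
  proof -
    have "(real q * r / 2) ^ m \<le> (2 * (real q * r / 2) - 1) ^ m"
      using qr by (intro power_mono) (auto simp: mult.commute)
    also have "\<dots> \<le> real (card P)" unfolding P_def
      using qr by (intro card_lattice_cube_ge[OF fin]) auto
    finally show ?thesis .
  qed
  have P_ne: "P \<noteq> {}"
  proof
    assume "P = {}"
    then have "(real q * r / 2) ^ m \<le> 0" using cardP by simp
    moreover have "(real q * r / 2) ^ m > 0" using q1 r by (intro zero_less_power) simp
    ultimately show False by linarith
  qed
  have inside: "\<bar>real_of_int (p k) / real q - z k\<bar> \<le> r / 2" if "p \<in> P" "k \<in> I" for p k
  proof -
    have "\<bar>real_of_int (p k) - real q * z k\<bar> \<le> real q * r / 2"
      using that by (auto simp: P_def lattice_cube_def)
    also have "\<bar>real_of_int (p k) - real q * z k\<bar> = real q * \<bar>real_of_int (p k) / real q - z k\<bar>"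
      using abs_mult[of "real q" "real_of_int (p k) / real q - z k"] q1
      by (simp add: right_diff_distrib)
    finally show ?thesis using q1 by (simp add: field_simps)
  qed
  define hit' where "hit' i p \<longleftrightarrow> hit (\<lambda>k. real_of_int (p k) / real q) (rad q) i" for i p
  have hit_sub: "hit z r i" if "p \<in> P" "hit' i p" for i p
    unfolding hit_def
  proof safe
    show "i \<in> T" using that(2) by (simp add: hit'_def hit_def)
    fix k assume k: "k \<in> I"
    have "\<bar>a i k - real_of_int (p k) / real q\<bar> \<le> e i + rad q"
      using that(2) k by (simp add: hit'_def hit_def)
    with inside[OF that(1) k] rad_r rad_pos show "\<bar>a i k - z k\<bar> \<le> e i + r" by linarith
  qed
  \<comment> \<open>The number of candidate cubes met by box \<open>i\<close>.\<close>
  define N' where "N' i = real (card {p \<in> P. hit' i p})" for i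
  have N'_le: "N' i \<le> (2 * (real q * e i) + 2) ^ m" for i
  proof -
    have "{p \<in> P. hit' i p} \<subseteq> lattice_cube I (\<lambda>k. real q * a i k) (real q * (e i + rad q))"
    proof safe
      fix p assume p: "p \<in> P" "hit' i p"
      show "p \<in> lattice_cube I (\<lambda>k. real q * a i k) (real q * (e i + rad q))"
        unfolding lattice_cube_def
      proof (rule PiE_I)
        fix k assume k: "k \<in> I"
        have "\<bar>a i k - real_of_int (p k) / real q\<bar> \<le> e i + rad q"
          using p(2) k by (simp add: hit'_def hit_def)
        then have "real q * \<bar>a i k - real_of_int (p k) / real q\<bar> \<le> real q * (e i + rad q)"
          by (intro mult_left_mono) auto
        also have "real q * \<bar>a i k - real_of_int (p k) / real q\<bar> = \<bar>real_of_int (p k) - real q * a i k\<bar>"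
          using abs_mult[of "real q" "a i k - real_of_int (p k) / real q"] q1
          by (simp add: right_diff_distrib abs_minus_commute)
        finally show "p k \<in> {j. \<bar>real_of_int j - real q * a i k\<bar> \<le> real q * (e i + rad q)}" by simp
      next
        fix k assume "k \<notin> I"
        then show "p k = undefined" using p(1) by (auto simp: P_def lattice_cube_def PiE_def extensional_def)
      qed
    qed
    then have "N' i \<le> real (card (lattice_cube I (\<lambda>k. real q * a i k) (real q * (e i + rad q))))"
      unfolding N'_def by (intro of_nat_mono card_mono finite_lattice_cube fin)
    also have "\<dots> \<le> (2 * (real q * (e i + rad q)) + 1) ^ m"
      using e_pos[of i] rad_pos by (intro card_lattice_cube_le fin) auto
    also have "\<dots> \<le> (2 * (real q * e i) + 2) ^ m"
      using rad_q e_pos[of i] rad_pos by (intro power_mono) (auto simp: algebra_simps)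
    finally show ?thesis .
  qed
  define w' where "w' i = min (w i) (2 * \<kappa>)" for i
  have w_pos: "w i > 0" for i using e_pos[of i] by (simp add: w_def)
  define b where "b i = 2 * 4 ^ m * (\<kappa> * real q ^ m) * r powr (real m - t) * (if hit z r i then w i else 0)
      + 4 ^ m * (if i \<ge> N \<and> i \<in> T then w i else 0)" for i
  have bound: "w' i * N' i \<le> b i" for i
  proof (cases "hit z r i")
    case False
    then have "{p \<in> P. hit' i p} = {}" using hit_sub by blast
    then have "N' i = 0" by (simp only: N'_def card.empty of_nat_0)
    then show ?thesis using w_pos[of i] by (simp add: b_def False)
  next
    case True
    have e_le: "e i \<le> r"
    proof -
      have "e i powr t \<le> \<epsilon> * r powr t" using hit_weight_le[OF True] ld by linarith
      also have "\<dots> \<le> 1 * r powr t" using eps by (intro mult_right_mono) auto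
      finally show ?thesis using powr_less_mono2[OF t_pos, of r "e i"] r by fastforce
    qed
    show ?thesis
    proof (cases "real q * e i \<ge> 1")
      case big: True
      have "N' i \<le> (4 * (real q * e i)) ^ m"
        using big by (intro order.trans[OF N'_le] power_mono) auto
      also have "\<dots> = 4 ^ m * real q ^ m * e i ^ m" by (simp add: power_mult_distrib)
      \<comment> \<open>Volume is dominated by weight for boxes smaller than the cube, because \<open>t < m\<close>.\<close>
      also have "e i ^ m = e i powr (real m - t) * w i"
        using e_pos[of i] by (simp add: w_def powr_add[symmetric] powr_realpow)
      also have "4 ^ m * real q ^ m * (e i powr (real m - t) * w i) \<le> 4 ^ m * real q ^ m * (r powr (real m - t) * w i)"
        using e_le e_pos[of i] w_pos[of i] t_less by (intro mult_left_mono mult_right_mono powr_mono2) auto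
      finally have "w' i * N' i \<le> (2 * \<kappa>) * (4 ^ m * real q ^ m * (r powr (real m - t) * w i))"
        using k_pos w_pos[of i] by (intro mult_mono) (auto simp: w'_def N'_def)
      also have "\<dots> \<le> b i" using True w_pos[of i] by (simp add: b_def algebra_simps)
      finally show ?thesis .
    next
      case small: False
      have "N' i \<le> 4 ^ m"
        using small e_pos[of i] by (intro order.trans[OF N'_le] power_mono) auto
      then have "w' i * N' i \<le> w i * 4 ^ m"
        using w_pos[of i] k_pos by (intro mult_mono) (auto simp: w'_def N'_def)
      also have "\<dots> \<le> b i"
      proof -
        have "i \<ge> N" using small qe[of i] by (meson not_le)
        moreover have "i \<in> T" using True by (simp add: hit_def)
        ultimately show ?thesis using w_pos[of i] k_pos q1 r True by (simp add: b_def algebra_simps)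
      qed
      finally show ?thesis .
    qed
  qed
  have tail: "summable (\<lambda>i. if i \<ge> N \<and> i \<in> T then w i else 0)"
    by (rule summable_comparison_test'[OF summable_T]) (auto simp: w_def)
  have "(\<Sum>i. if i \<ge> N \<and> i \<in> T then w i else 0) =
      (\<Sum>i. if i + N \<ge> N \<and> i + N \<in> T then w (i + N) else 0) + (\<Sum>i<N. if i \<ge> N \<and> i \<in> T then w i else 0)"
    by (rule suminf_split_initial_segment[OF tail])
  also have "(\<Sum>i<N. if i \<ge> N \<and> i \<in> T then w i else 0) = 0" by (intro sum.neutral) auto
  also have "(\<Sum>i. if i + N \<ge> N \<and> i + N \<in> T then w (i + N) else 0) \<le> \<tau>"
    using N[of N] by simp
  finally have tail_le: "(\<Sum>i. if i \<ge> N \<and> i \<in> T then w i else 0) \<le> \<tau>" by simp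
  have hits: "summable (\<lambda>i. if hit z r i then w i else 0)"
    unfolding w_def by (rule summable_hit)
  have b_sum: "summable b" unfolding b_def
    by (intro summable_add summable_mult hits tail)
  have "suminf b = 2 * 4 ^ m * (\<kappa> * real q ^ m) * r powr (real m - t) * load z r
      + 4 ^ m * (\<Sum>i. if i \<ge> N \<and> i \<in> T then w i else 0)"
    unfolding b_def load_def w_def[symmetric]
    by (simp only: suminf_add[symmetric] suminf_mult summable_mult hits tail)
  also have "\<dots> \<le> 2 * 4 ^ m * (\<kappa> * real q ^ m) * r powr (real m - t) * (\<epsilon> * r powr t) + 4 ^ m * \<tau>"
    using ld k_pos tail_le by (intro add_mono mult_left_mono) auto
  also have "\<dots> = (\<epsilon> * 2 powr (-t) * r ^ m / 2 ^ m) / 4 + (\<epsilon> * 2 powr (-t) * r ^ m / 2 ^ m) / 4"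
  proof -
    have "r powr (real m - t) * r powr t = r ^ m"
      using r by (simp add: powr_add[symmetric] powr_realpow)
    then have "2 * 4 ^ m * (\<kappa> * real q ^ m) * r powr (real m - t) * (\<epsilon> * r powr t)
        = 2 * 4 ^ m * \<epsilon> * (\<epsilon> * 2 powr (-t) * r ^ m)" by (simp add: kq algebra_simps)
    moreover have "2 * 4 ^ m * \<epsilon> = 1 / (4 * 2 ^ m)"
      using power_mult_distrib[of "2::real" 4 m] by (simp add: \<epsilon>_def)
    moreover have "4 ^ m * \<tau> = (\<epsilon> * 2 powr (-t) * r ^ m / 2 ^ m) / 4"
      using power_mult_distrib[of "2::real" 4 m] by (simp add: \<tau>_def)
    ultimately show ?thesis by simp
  qed
  also have "\<dots> \<le> \<epsilon> * 2 powr (-t) * r ^ m / 2 ^ m"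
  proof -
    have "0 \<le> \<epsilon> * 2 powr (-t) * r ^ m / 2 ^ m" using eps r by simp
    then show ?thesis by linarith
  qed
  also have "\<dots> = (real q * r / 2) ^ m * \<kappa>"
    unfolding kq[symmetric] by (simp add: power_mult_distrib power_divide)
  also have "\<dots> \<le> real (card P) * \<kappa>"
    using cardP k_pos by (intro mult_right_mono) auto
  finally have b_le: "suminf b \<le> real (card P) * \<kappa>" .
  have w'_nonneg: "0 \<le> w' i" for i using w_pos[of i] k_pos by (simp add: w'_def)
  obtain p where p: "p \<in> P" and p_sum: "summable (\<lambda>i. if hit' i p then w' i else 0)"
    and p_le: "(\<Sum>i. if hit' i p then w' i else 0) \<le> \<kappa>"
    by (rule averaging[OF P_fin P_ne w'_nonneg bound[unfolded N'_def] b_sum b_le])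
  have "w' i = w i" if "hit' i p" for i
  proof -
    have "(\<Sum>j\<in>{i}. if hit' j p then w' j else 0) \<le> (\<Sum>j. if hit' j p then w' j else 0)"
      by (rule sum_le_suminf[OF p_sum]) (auto simp: w'_nonneg)
    then have "w' i \<le> \<kappa>" using that p_le by simp
    then show ?thesis using k_pos by (auto simp: w'_def min_def split: if_splits)
  qed
  then have "(\<lambda>i. if hit' i p then w' i else 0) = (\<lambda>i. if hit' i p then w i else 0)" by auto
  then have "load (\<lambda>k. real_of_int (p k) / real q) (rad q) \<le> \<epsilon> * rad q powr t"
    using p_le unfolding load_def hit'_def w_def \<kappa>_def by simp
  moreover have "\<bar>real_of_int (p k) / real q - z k\<bar> + rad q \<le> r" if "k \<in> I" for k
    using inside[OF p that] rad_r rad_pos by linarith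
  moreover have "2 * rad q \<le> r" using rad_r rad_pos by linarith
  ultimately show ?thesis using q(1) q_gt by blast
qed

text \<open>
  Iterating the previous step gives nested cubes. Their common point is approximable along \<open>Q\<close>. It lies
  in no box: a box through it would meet every cube, so its fixed positive weight would be bounded
  by loads tending to 0.
\<close>

lemma uncovered_point:
  assumes r0: "0 < r0" and ld0: "load z0 r0 \<le> \<epsilon> * r0 powr t"
  obtains y where "\<forall>k\<in>I. \<bar>y k - z0 k\<bar> \<le> r0"
    "infinite {q \<in> Q. q > 0 \<and> (\<exists>p::'k \<Rightarrow> int. \<forall>k\<in>I. \<bar>y k - of_int (p k) / real q\<bar> < real q powr (- \<nu>))}"
    "\<forall>i\<in>T. \<exists>k\<in>I. \<bar>y k - a i k\<bar> > e i"
proof -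
  define good where "good n = (\<lambda>(z, r, q::nat). 0 < r \<and> load z r \<le> \<epsilon> * r powr t \<and> (n = (0::nat) \<longrightarrow> (z, r, q) = (z0, r0, 0)))" for n
  define next_cube where "next_cube n = (\<lambda>(z, r, q) (z', r', q'). q' \<in> Q \<and> q' > q \<and> r' = rad q' \<and> 2 * r' \<le> r \<and>
    (\<exists>p::'k \<Rightarrow> int. z' = (\<lambda>k. of_int (p k) / real q')) \<and> (\<forall>k\<in>I. \<bar>z' k - z k\<bar> + r' \<le> r))" for n :: nat
  have "\<exists>f. \<forall>n. good n (f n) \<and> next_cube n (f n) (f (Suc n))"
  proof (rule dependent_nat_choice)
    show "\<exists>x. good 0 x" using r0 ld0 by (auto simp: good_def)
    fix x n assume "good n x"
    moreover obtain z r q0 where x: "x = (z, r, q0)" by (cases x)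
    ultimately have "0 < r" "load z r \<le> \<epsilon> * r powr t" by (auto simp: good_def)
    from lighter_subcube[OF this, of q0] obtain q p where
      "q \<in> Q" "q > q0" "\<forall>k\<in>I. \<bar>real_of_int (p k) / real q - z k\<bar> + rad q \<le> r"
      "2 * rad q \<le> r" "load (\<lambda>k. real_of_int (p k) / real q) (rad q) \<le> \<epsilon> * rad q powr t"
      by blast
    moreover from \<open>q > q0\<close> have "rad q > 0" by (simp add: rad_def)
    ultimately have "good (Suc n) (\<lambda>k. real_of_int (p k) / real q, rad q, q) \<and>
        next_cube n x (\<lambda>k. real_of_int (p k) / real q, rad q, q)"
      unfolding good_def next_cube_def x by auto
    then show "\<exists>y. good (Suc n) y \<and> next_cube n x y" by blast
  qed
  then obtain f where f: "\<And>n. good n (f n)" "\<And>n. next_cube n (f n) (f (Suc n))" by blast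
  define z where "z n = fst (f n)" for n
  define r where "r n = fst (snd (f n))" for n
  define q where "q n = snd (snd (f n))" for n
  have f_eq: "f n = (z n, r n, q n)" for n by (simp add: z_def r_def q_def)
  have r_pos: "0 < r n" and ld: "load (z n) (r n) \<le> \<epsilon> * r n powr t" for n
    using f(1)[of n] unfolding f_eq good_def by auto
  have init: "z 0 = z0" "r 0 = r0" using f(1)[of 0] unfolding f_eq good_def by auto
  have q_Q: "q (Suc n) \<in> Q" and q_mono: "q n < q (Suc n)" and r_rad: "r (Suc n) = rad (q (Suc n))"
    and r_half: "2 * r (Suc n) \<le> r n"
    and z_eq: "\<exists>p::'k \<Rightarrow> int. z (Suc n) = (\<lambda>k. of_int (p k) / real (q (Suc n)))"
    and nest: "\<And>k. k \<in> I \<Longrightarrow> \<bar>z (Suc n) k - z n k\<bar> + r (Suc n) \<le> r n" for n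
    using f(2)[of n] unfolding f_eq next_cube_def by auto
  have r_le: "r n \<le> r0 * (1/2) ^ n" for n
  proof (induction n)
    case (Suc n)
    then show ?case using r_half[of n] by simp
  qed (simp add: init)
  have r_lim: "r \<longlonglongrightarrow> 0"
  proof (rule Lim_null_comparison)
    show "(\<lambda>n. r0 * (1/2) ^ n) \<longlonglongrightarrow> 0"
      by (intro tendsto_mult_right_zero LIMSEQ_realpow_zero) auto
    show "\<forall>\<^sub>F n in sequentially. norm (r n) \<le> r0 * (1/2) ^ n"
      using r_le r_pos by (simp add: less_imp_le)
  qed
  define y where "y k = (SUP n. z n k - r n)" for k
  have y: "\<bar>y k - z n k\<bar> \<le> r n" if k: "k \<in> I" for n k
  proof -
    have step: "z n k - r n \<le> z (Suc n) k - r (Suc n)" "z (Suc n) k + r (Suc n) \<le> z n k + r n" for n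
      using nest[OF k, of n] by linarith+
    have lo: "z i k - r i \<le> z j k - r j" if "i \<le> j" for i j
      by (rule lift_Suc_mono_le[where f = "\<lambda>n. z n k - r n", OF step(1) that])
    have hi: "z j k + r j \<le> z i k + r i" if "i \<le> j" for i j
      by (rule lift_Suc_antimono_le[where f = "\<lambda>n. z n k + r n", OF step(2) that])
    have cross: "z i k - r i \<le> z j k + r j" for i j
      using lo[of i "max i j"] hi[of j "max i j"] r_pos[of "max i j"] by linarith
    have "y k \<le> z n k + r n" unfolding y_def by (rule cSUP_least) (auto intro: cross)
    moreover have "z n k - r n \<le> y k" unfolding y_def
      by (rule cSUP_upper) (auto intro!: bdd_aboveI[of _ "z n k + r n"] cross)
    ultimately show ?thesis by linarith
  qed
  have "\<forall>k\<in>I. \<bar>y k - z0 k\<bar> \<le> r0" using y[of _ 0] by (simp add: init)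
  moreover have "infinite {q \<in> Q. q > 0 \<and> (\<exists>p::'k \<Rightarrow> int. \<forall>k\<in>I. \<bar>y k - of_int (p k) / real q\<bar> < real q powr (- \<nu>))}"
  proof (rule infinite_super)
    have q_strict: "strict_mono q" using q_mono by (simp add: strict_mono_Suc_iff)
    have "inj (\<lambda>n. q (Suc n))"
      using q_strict by (auto simp: inj_def strict_mono_eq)
    then show "infinite (range (\<lambda>n. q (Suc n)))" by (rule range_inj_infinite)
    show "range (\<lambda>n. q (Suc n)) \<subseteq> {q \<in> Q. q > 0 \<and> (\<exists>p::'k \<Rightarrow> int. \<forall>k\<in>I. \<bar>y k - of_int (p k) / real q\<bar> < real q powr (- \<nu>))}"
    proof safe
      fix n
      show "q (Suc n) \<in> Q" by (rule q_Q)
      show q_pos: "q (Suc n) > 0" using q_mono[of n] by simp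
      obtain p :: "'k \<Rightarrow> int" where p: "z (Suc n) = (\<lambda>k. of_int (p k) / real (q (Suc n)))" using z_eq by blast
      have "\<bar>y k - of_int (p k) / real (q (Suc n))\<bar> < real (q (Suc n)) powr (- \<nu>)" if "k \<in> I" for k
      proof -
        have "\<bar>y k - of_int (p k) / real (q (Suc n))\<bar> \<le> rad (q (Suc n))"
          using y[OF that, of "Suc n"] by (simp add: p r_rad)
        also have "\<dots> < real (q (Suc n)) powr (- \<nu>)" using q_pos by (simp add: rad_def)
        finally show ?thesis .
      qed
      then show "\<exists>p::'k \<Rightarrow> int. \<forall>k\<in>I. \<bar>y k - of_int (p k) / real (q (Suc n))\<bar> < real (q (Suc n)) powr (- \<nu>)" by blast
    qed
  qed
  moreover have "\<exists>k\<in>I. \<bar>y k - a i k\<bar> > e i" if i: "i \<in> T" for i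
  proof (rule ccontr)
    assume "\<not> ?thesis"
    then have in_box: "\<bar>y k - a i k\<bar> \<le> e i" if "k \<in> I" for k
      using that by (auto simp: not_less)
    have "hit (z n) (r n) i" for n
      unfolding hit_def using i
    proof (intro conjI ballI)
      show "\<bar>a i k - z n k\<bar> \<le> e i + r n" if "k \<in> I" for k
        using in_box[OF that] y[OF that, of n] by linarith
    qed
    then have "e i powr t \<le> \<epsilon> * r n powr t" for n
      using hit_weight_le[of "z n" "r n" i] ld[of n] order.trans by blast
    moreover have "(\<lambda>n. \<epsilon> * r n powr t) \<longlonglongrightarrow> \<epsilon> * 0 powr t"
      using t_pos r_pos by (intro tendsto_intros tendsto_powr' r_lim) (auto intro!: always_eventually less_imp_le)
    ultimately have "e i powr t \<le> \<epsilon> * 0 powr t"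
      using LIMSEQ_le_const by blast
    then show False using e_pos[of i] by simp
  qed
  ultimately show ?thesis using that by blast
qed

text \<open>
  The starting cube. A box of radius at most \<open>1 / K\<close> meets at most \<open>4 ^ m\<close> of the \<open>K ^ m\<close> cubes of the grid.
\<close>

lemma light_grid_cube:
  assumes K: "K > 0" and e_le: "\<And>i. e i \<le> 1 / real K"
    and total: "4 ^ m * (\<Sum>i. if i \<in> T then e i powr t else 0) \<le> real K ^ m * (\<epsilon> * (1 / (2 * real K)) powr t)"
  obtains z where "\<forall>k\<in>I. 1 / (2 * real K) \<le> z k \<and> z k \<le> 1 - 1 / (2 * real K)"
    "load z (1 / (2 * real K)) \<le> \<epsilon> * (1 / (2 * real K)) powr t"
proof -
  define P where "P = (\<Pi>\<^sub>E k\<in>I. {0..<int K})"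
  have P: "finite P" "P \<noteq> {}" "card P = K ^ m"
    using K fin by (simp_all add: P_def card_PiE PiE_eq_empty_iff finite_PiE)
  define c where "c p k = (real_of_int (p k) + 1/2) / real K" for p :: "'k \<Rightarrow> int" and k
  define hit' where "hit' i p \<longleftrightarrow> hit (c p) (1 / (2 * real K)) i" for i p
  have bound: "e i powr t * real (card {p \<in> P. hit' i p}) \<le> 4 ^ m * (if i \<in> T then e i powr t else 0)" for i
  proof (cases "i \<in> T")
    case False
    then have "{p \<in> P. hit' i p} = {}" by (auto simp: hit'_def hit_def)
    then show ?thesis using False by (simp only: card.empty) simp
  next
    case True
    have "{p \<in> P. hit' i p} \<subseteq> lattice_cube I (\<lambda>k. real K * a i k - 1/2) (3/2)"
    proof safe
      fix p assume p: "p \<in> P" "hit' i p"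
      show "p \<in> lattice_cube I (\<lambda>k. real K * a i k - 1/2) (3/2)"
        unfolding lattice_cube_def
      proof (rule PiE_I)
        fix k assume k: "k \<in> I"
        have "\<bar>a i k - c p k\<bar> \<le> 1 / real K + 1 / (2 * real K)"
          using p(2) k e_le[of i] unfolding hit'_def hit_def by fastforce
        then have "real K * \<bar>a i k - c p k\<bar> \<le> real K * (1 / real K + 1 / (2 * real K))"
          by (intro mult_left_mono) auto
        also have "\<dots> = 3/2" using K by (simp add: field_simps)
        also have "real K * \<bar>a i k - c p k\<bar> = \<bar>real_of_int (p k) - (real K * a i k - 1/2)\<bar>"
          using abs_mult[of "real K" "a i k - c p k"] K
          by (simp add: c_def right_diff_distrib abs_minus_commute diff_diff_eq2 add_diff_eq diff_add_eq)
        finally show "p k \<in> {j. \<bar>real_of_int j - (real K * a i k - 1/2)\<bar> \<le> 3/2}" by simp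
      next
        fix k assume "k \<notin> I"
        then show "p k = undefined" using p(1) by (auto simp: P_def PiE_def extensional_def)
      qed
    qed
    then have "real (card {p \<in> P. hit' i p}) \<le> real (card (lattice_cube I (\<lambda>k. real K * a i k - 1/2) (3/2)))"
      by (intro of_nat_mono card_mono finite_lattice_cube fin)
    also have "\<dots> \<le> 4 ^ m"
      using card_lattice_cube_le[OF fin, of "3/2" "\<lambda>k. real K * a i k - 1/2"] by simp
    finally have "e i powr t * real (card {p \<in> P. hit' i p}) \<le> e i powr t * 4 ^ m"
      by (rule mult_left_mono) simp
    then show ?thesis using True by (simp add: mult.commute)
  qed
  obtain p where p: "p \<in> P" and le: "(\<Sum>i. if hit' i p then e i powr t else 0) \<le> \<epsilon> * (1 / (2 * real K)) powr t"
  proof (rule averaging[OF P(1,2) _ bound])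
    show "summable (\<lambda>i. 4 ^ m * (if i \<in> T then e i powr t else 0))"
      by (intro summable_mult summable_T)
    show "(\<Sum>i. 4 ^ m * (if i \<in> T then e i powr t else 0)) \<le> real (card P) * (\<epsilon> * (1 / (2 * real K)) powr t)"
      using total P(3) by (simp add: suminf_mult[OF summable_T])
  qed auto
  show ?thesis
  proof (rule that)
    show "load (c p) (1 / (2 * real K)) \<le> \<epsilon> * (1 / (2 * real K)) powr t"
      using le unfolding load_def hit'_def .
    show "\<forall>k\<in>I. 1 / (2 * real K) \<le> c p k \<and> c p k \<le> 1 - 1 / (2 * real K)"
    proof
      fix k assume "k \<in> I"
      then have "0 \<le> p k" "p k + 1 \<le> int K" using p by (auto simp: P_def PiE_def Pi_def)
      then have "0 \<le> real_of_int (p k)" "real_of_int (p k) + 1 \<le> real K"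
        by linarith+
      then show "1 / (2 * real K) \<le> c p k \<and> c p k \<le> 1 - 1 / (2 * real K)"
      proof -
        assume p_ge: "0 \<le> real_of_int (p k)" and "real_of_int (p k) + 1 \<le> real K"
        then have "(real_of_int (p k) + 1) / real K \<le> 1" using K by simp
        moreover have "0 \<le> real_of_int (p k) / real K" using p_ge by simp
        moreover have "c p k = real_of_int (p k) / real K + 1 / (2 * real K)"
          "c p k = (real_of_int (p k) + 1) / real K - 1 / (2 * real K)"
          by (simp_all add: c_def add_divide_distrib)
        ultimately show ?thesis by linarith
      qed
    qed
  qed
qed

end

text \<open>
  The bound \<open>G\<close> is arbitrary because the required inequality between \<open>G\<close> and the number \<open>K\<close> of grid
  cubes per side is \<open>G \<le> const * K powr (m - t)\<close> with \<open>t < m\<close>. The scale \<open>\<delta>\<close> is independent of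
  \<open>Q\<close>; this uniformity allows the slicing argument to treat all fibres at once.
\<close>

lemma fibre_cover:
  fixes I :: "'k set" and \<nu> G :: real
  assumes I: "finite I" "I \<noteq> {}" and nu: "\<nu> > 1" 
  obtains \<delta> :: real where "\<delta> > 0"
    "\<And>(Q :: nat set) (a :: nat \<Rightarrow> 'k \<Rightarrow> real) e T. infinite Q \<Longrightarrow> (\<And>i. 0 < e i \<and> e i \<le> \<delta>) \<Longrightarrow>
      (\<And>y. \<forall>k\<in>I. 0 \<le> y k \<and> y k \<le> 1 \<Longrightarrow>
        infinite {q \<in> Q. q > 0 \<and> (\<exists>p::'k \<Rightarrow> int. \<forall>k\<in>I. \<bar>y k - of_int (p k) / real q\<bar> < real q powr (- \<nu>))} \<Longrightarrow>
        \<exists>i\<in>T. \<forall>k\<in>I. \<bar>y k - a i k\<bar> \<le> e i) \<Longrightarrow>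
      ennreal G \<le> (\<Sum>i. if i \<in> T then ennreal (e i powr (real (card I) / \<nu>)) else 0)"
proof -
  define m where "m = card I"
  define t where "t = real m / \<nu>"
  define \<epsilon>' :: real where "\<epsilon>' = 1 / (8 * 8 ^ m)"
  have m: "m > 0" using I by (simp add: m_def card_gt_0_iff)
  have t: "0 < t" "t < real m" using m nu by (auto simp: t_def divide_less_eq)
  have "filterlim (\<lambda>K::nat. real K powr (real m - t)) at_top sequentially"
    using t(2) by (intro filterlim_compose[OF real_powr_at_top filterlim_real_sequentially]) simp
  then have "eventually (\<lambda>K::nat. 4 ^ m * 2 powr t * G / \<epsilon>' \<le> real K powr (real m - t)) sequentially"
    by (simp add: filterlim_at_top)
  then have "eventually (\<lambda>K::nat. K > 0 \<and> 4 ^ m * 2 powr t * G / \<epsilon>' \<le> real K powr (real m - t)) sequentially"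
    using eventually_gt_at_top[of 0] by eventually_elim auto
  then obtain K :: nat where K: "K > 0" "4 ^ m * 2 powr t * G / \<epsilon>' \<le> real K powr (real m - t)"
    using eventually_happens'[OF sequentially_bot] by blast
  have eps: "\<epsilon>' > 0" by (simp add: \<epsilon>'_def)
  have KG: "4 ^ m * G \<le> real K ^ m * (\<epsilon>' * (1 / (2 * real K)) powr t)"
  proof -
    have "real K ^ m * (\<epsilon>' * (1 / (2 * real K)) powr t) = \<epsilon>' * 2 powr (-t) * real K powr (real m - t)"
    proof -
      have "(1 / (2 * real K)) powr t = 2 powr (-t) * real K powr (-t)"
        by (simp add: powr_divide powr_mult powr_minus_divide)
      moreover have "real K ^ m * real K powr (-t) = real K powr (real m - t)"
        using K(1) by (simp add: powr_diff powr_realpow powr_minus_divide)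
      ultimately show ?thesis by (simp add: algebra_simps)
    qed
    moreover have "4 ^ m * G = \<epsilon>' * 2 powr (-t) * (4 ^ m * 2 powr t * G / \<epsilon>')"
      using eps by (simp add: powr_minus field_simps)
    ultimately show ?thesis using K(2) eps by (simp only:) (intro mult_left_mono, auto)
  qed
  show ?thesis
  proof (rule that[of "1 / real K"])
    show "1 / real K > 0" using K(1) by simp
    fix Q :: "nat set" and a :: "nat \<Rightarrow> 'k \<Rightarrow> real" and e T
    assume Q: "infinite Q" and e: "\<And>i. 0 < e i \<and> e i \<le> 1 / real K"
      and cov: "\<And>y. \<forall>k\<in>I. 0 \<le> y k \<and> y k \<le> 1 \<Longrightarrow>
        infinite {q \<in> Q. q > 0 \<and> (\<exists>p::'k \<Rightarrow> int. \<forall>k\<in>I. \<bar>y k - of_int (p k) / real q\<bar> < real q powr (- \<nu>))} \<Longrightarrow>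
        \<exists>i\<in>T. \<forall>k\<in>I. \<bar>y k - a i k\<bar> \<le> e i"
    show "ennreal G \<le> (\<Sum>i. if i \<in> T then ennreal (e i powr (real (card I) / \<nu>)) else 0)"
    proof (rule ccontr)
      define g where "g i = (if i \<in> T then e i powr (real (card I) / \<nu>) else 0)" for i
      have g_nonneg: "0 \<le> g i" for i by (simp add: g_def)
      assume "\<not> ?thesis"
      then have less: "(\<Sum>i. ennreal (g i)) < ennreal G"
        by (simp add: g_def if_distrib[of ennreal] not_le cong: if_cong)
      then have sum_g: "summable g"
        using g_nonneg by (intro summable_suminf_not_top) (auto simp: top_unique)
      have "ennreal (suminf g) < ennreal G"
        using less suminf_ennreal2[OF g_nonneg sum_g] by simp
      then have g_less: "suminf g < G"
        by (meson ennreal_leI not_le)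
      interpret boxes I T a e \<nu> Q
      proof
        have "(\<lambda>i. if i \<in> T then e i powr (real (card I) / \<nu>) else 0) = g"
          by (simp add: g_def fun_eq_iff)
        then show "summable (\<lambda>i. if i \<in> T then e i powr (real (card I) / \<nu>) else 0)"
          using sum_g by simp
      qed (use I nu Q e in auto)
      have "4 ^ card I * suminf g \<le> 4 ^ card I * G" using g_less by simp
      also have "\<dots> \<le> real K ^ card I * (\<epsilon> * (1 / (2 * real K)) powr (real (card I) / \<nu>))"
        using KG unfolding m_def t_def \<epsilon>'_def \<epsilon>_def .
      finally obtain z where z: "\<forall>k\<in>I. 1 / (2 * real K) \<le> z k \<and> z k \<le> 1 - 1 / (2 * real K)"
        and ld: "load z (1 / (2 * real K)) \<le> \<epsilon> * (1 / (2 * real K)) powr (real (card I) / \<nu>)"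
        using light_grid_cube[OF K(1)] e unfolding g_def by blast
      obtain y where y: "\<forall>k\<in>I. \<bar>y k - z k\<bar> \<le> 1 / (2 * real K)"
        "infinite {q \<in> Q. q > 0 \<and> (\<exists>p::'k \<Rightarrow> int. \<forall>k\<in>I. \<bar>y k - of_int (p k) / real q\<bar> < real q powr (- \<nu>))}"
        "\<forall>i\<in>T. \<exists>k\<in>I. \<bar>y k - a i k\<bar> > e i"
        using uncovered_point[OF _ ld] K(1) by auto
      have "\<forall>k\<in>I. 0 \<le> y k \<and> y k \<le> 1"
        using y(1) z by (fastforce simp: abs_le_iff)
      from cov[OF this y(2)] y(3) show False by force
    qed
  qed
qed

section \<open>Weighted coverings of subsets of the line\<close>

lemma dyadic_scale:
  fixes d :: real
  assumes "0 < d" "d \<le> 1"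
  obtains l where "d \<le> (1/2) ^ l" "(1/2) ^ l < 2 * d"
proof -
  obtain N where N: "(1/2) ^ N < d"
    using real_arch_pow_inv[of d "1/2"] assms(1) by auto
  define l where "l = (LEAST n. (1/2) ^ n < d) - 1"
  have L: "(1/2) ^ (LEAST n. (1/2) ^ n < d) < d" using N by (rule LeastI)
  have pos: "(LEAST n. (1/2) ^ n < d) \<noteq> 0"
    using L assms(2) by (metis not_le power_0)
  then have suc: "(LEAST n. (1/2) ^ n < d) = Suc l" by (simp add: l_def)
  show ?thesis
  proof (rule that)
    show "d \<le> (1/2) ^ l"
      using not_less_Least[of l "\<lambda>n. (1/2) ^ n < d"] suc by simp
    show "(1/2) ^ l < 2 * d" using L unfolding suc by simp
  qed
qed

text \<open>The probability, up to normalisation by \<open>G\<close>, that a threshold falls into a given step.\<close>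

lemma emeasure_threshold_le:
  fixes S b :: ennreal
  shows "emeasure lborel {\<theta>. 0 < \<theta> \<and> \<theta> < G \<and> S < ennreal \<theta> \<and> ennreal \<theta> \<le> S + b} \<le> b"
    (is "emeasure _ ?X \<le> _")
proof (cases S)
  case top
  then have "?X = {}" by auto
  then show ?thesis by (simp only: emeasure_empty zero_le)
next
  case S: (real S')
  show ?thesis
  proof (cases b)
    case b: (real b')
    have "?X \<subseteq> {S'..S' + b'}"
      using S b by (auto simp: ennreal_plus[symmetric] ennreal_less_iff ennreal_le_iff simp del: ennreal_plus)
    then have "emeasure lborel ?X \<le> emeasure lborel {S'..S' + b'}" by (rule emeasure_mono) simp
    then show ?thesis using b by simp
  qed simp
qed

lemma suminf_ennreal_swap:
  fixes f :: "nat \<Rightarrow> nat \<Rightarrow> ennreal"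
  shows "(\<Sum>i. \<Sum>j. f i j) = (\<Sum>j. \<Sum>i. f i j)"
  using nn_integral_suminf[of "\<lambda>j i. f i j" "count_space UNIV"]
  by (simp add: nn_integral_count_space_nat)

lemma hausdorff_content_le:
  assumes "A \<subseteq> (\<Union>n. U n)" "\<And>n. bounded (U n)" "\<And>n. diameter (U n) \<le> \<delta>"
  shows "hausdorff_content s \<delta> A \<le> (\<Sum>n. diam_weight s (U n))"
  unfolding hausdorff_content_def by (rule INF_lower) (use assms in auto)

text \<open>
  Each interval is replaced by at most two dyadic intervals of comparable length that contain it in
  their union, and they inherit its weight. Along the branch of dyadic intervals containing a point
  of \<open>A\<close> the weights add up to at least \<open>G\<close>. Given a threshold \<open>\<theta> < G\<close>, select the dyadic
  intervals at which the accumulated weight passes \<open>\<theta>\<close>: every point of \<open>A\<close> lies in one of them. For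
  uniformly random \<open>\<theta>\<close> an interval is selected with probability at most its weight divided by
  \<open>G\<close>, so some \<open>\<theta>\<close> gives a covering that is not more expensive than the weighted one divided
  by \<open>G\<close>, up to a constant.
\<close>

lemma weighted_cover_content:
  fixes A :: "real set" and a e v :: "nat \<Rightarrow> real"
  assumes s: "s > 0" and e: "\<And>i. 0 < e i" "\<And>i. e i \<le> \<delta>" and \<delta>: "\<delta> \<le> 1/2"
    and v: "\<And>i. 0 \<le> v i" and G: "G > 0" and M: "M > 0"
    and cov: "\<And>x. x \<in> A \<Longrightarrow> ennreal G \<le> (\<Sum>i. if \<bar>x - a i\<bar> \<le> e i then ennreal (v i) else 0)"
    and total: "(\<Sum>i. ennreal (v i * e i powr s)) \<le> ennreal M"
  shows "hausdorff_content s (4 * \<delta>) A \<le> ennreal (4 * 4 powr s * M / G)"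
proof -
  have "\<exists>l. 2 * e i \<le> (1/2) ^ l \<and> (1/2) ^ l < 4 * e i" for i
  proof -
    have "0 < 2 * e i" "2 * e i \<le> 1" using e(1)[of i] e(2)[of i] \<delta> by linarith+
    then obtain l where "2 * e i \<le> (1/2) ^ l" "(1/2) ^ l < 2 * (2 * e i)" by (rule dyadic_scale)
    then show ?thesis by (intro exI[of _ l]) simp
  qed
  then obtain lev where lev: "\<And>i. 2 * e i \<le> (1/2) ^ lev i" "\<And>i. (1/2) ^ lev i < 4 * e i"
    by metis
  define meets where "meets i l k \<longleftrightarrow> lev i = l \<and> k \<in> {\<lfloor>(a i - e i) * 2 ^ l\<rfloor>, \<lfloor>(a i + e i) * 2 ^ l\<rfloor>}" for i l k
  define b where "b l k = (\<Sum>i. if meets i l k then ennreal (v i) else 0)" for l k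
  \<comment> \<open>The weight collected strictly above the dyadic interval \<open>(l, k)\<close>; its ancestor at
    level \<open>j\<close> has index \<open>k div 2 ^ (l - j)\<close>.\<close>
  define S where "S l k = (\<Sum>j<l. b j (k div 2 ^ (l - j)))" for l k
  define sel where "sel \<theta> = (\<lambda>(l, k). S l k < ennreal \<theta> \<and> ennreal \<theta> \<le> S l k + b l k)" for \<theta>
  define D where "D = (\<lambda>(l, k). {x::real. \<lfloor>x * 2 ^ l\<rfloor> = k})"
  define len where "len p = ennreal (((1/2) ^ fst p) powr s)" for p :: "nat \<times> int"
  have D_dist: "dist x y \<le> (1/2) ^ l" if "x \<in> D (l, k)" "y \<in> D (l, k)" for x y l k
  proof -
    have "\<bar>x * 2 ^ l - y * 2 ^ l\<bar> \<le> 1" using that unfolding D_def by auto linarith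
    moreover have "\<bar>x * 2 ^ l - y * 2 ^ l\<bar> = \<bar>x - y\<bar> * 2 ^ l"
      using abs_mult[of "x - y" "2 ^ l"] by (simp add: left_diff_distrib)
    ultimately show ?thesis by (simp add: dist_real_def field_simps power_divide)
  qed
  have D_bounded: "bounded (D p)" for p
    using D_dist by (cases p) (metis bounded_def)
  have D_diam: "diameter (D (l, k)) \<le> (1/2) ^ l" for l k
    by (rule diameter_le) (use D_dist in \<open>auto simp: dist_norm\<close>)
  have D_weight: "diam_weight s (D p) \<le> len p" for p
    using s D_diam[of "fst p" "snd p"] diameter_ge_0[OF D_bounded[of p]]
    by (auto simp: diam_weight_def len_def intro!: ennreal_leI powr_mono2)
  have meets_point: "meets i (lev i) \<lfloor>x * 2 ^ lev i\<rfloor>" if "\<bar>x - a i\<bar> \<le> e i" for i x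
  proof -
    have "(a i - e i) * 2 ^ lev i \<le> x * 2 ^ lev i" "x * 2 ^ lev i \<le> (a i + e i) * 2 ^ lev i"
      using that by (auto intro!: mult_right_mono)
    then have "\<lfloor>(a i - e i) * 2 ^ lev i\<rfloor> \<le> \<lfloor>x * 2 ^ lev i\<rfloor>" "\<lfloor>x * 2 ^ lev i\<rfloor> \<le> \<lfloor>(a i + e i) * 2 ^ lev i\<rfloor>"
      by (auto intro: floor_mono)
    moreover have "(a i + e i) * 2 ^ lev i \<le> (a i - e i) * 2 ^ lev i + 1"
      using lev(1)[of i] by (simp add: field_simps power_divide)
    then have "\<lfloor>(a i + e i) * 2 ^ lev i\<rfloor> \<le> \<lfloor>(a i - e i) * 2 ^ lev i\<rfloor> + 1"
      using floor_mono by fastforce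
    ultimately show ?thesis unfolding meets_def by auto
  qed
  have branch: "S l \<lfloor>x * 2 ^ l\<rfloor> = (\<Sum>j<l. b j \<lfloor>x * 2 ^ j\<rfloor>)" for l and x :: real
    unfolding S_def
  proof (intro sum.cong refl)
    fix j assume "j \<in> {..<l}"
    then have "(2::real) ^ l = 2 ^ j * 2 ^ (l - j)" by (simp add: power_add[symmetric])
    then have "x * 2 ^ j = (x * 2 ^ l) / real_of_int (2 ^ (l - j))" by simp
    then have "\<lfloor>x * 2 ^ j\<rfloor> = \<lfloor>x * 2 ^ l\<rfloor> div 2 ^ (l - j)"
      by (simp only:) (subst floor_divide_real_eq_div, auto)
    then show "b j (\<lfloor>x * 2 ^ l\<rfloor> div 2 ^ (l - j)) = b j \<lfloor>x * 2 ^ j\<rfloor>" by simp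
  qed
  have branch_total: "ennreal G \<le> (\<Sum>j. b j \<lfloor>x * 2 ^ j\<rfloor>)" if "x \<in> A" for x
  proof -
    have "ennreal G \<le> (\<Sum>i. if \<bar>x - a i\<bar> \<le> e i then ennreal (v i) else 0)" by (rule cov[OF that])
    also have "\<dots> \<le> (\<Sum>i. \<Sum>j. if meets i j \<lfloor>x * 2 ^ j\<rfloor> then ennreal (v i) else 0)"
    proof (rule suminf_le)
      fix i
      have "(if \<bar>x - a i\<bar> \<le> e i then ennreal (v i) else 0) \<le> (\<Sum>j\<in>{lev i}. if meets i j \<lfloor>x * 2 ^ j\<rfloor> then ennreal (v i) else 0)"
        using meets_point by auto
      also have "\<dots> \<le> (\<Sum>j. if meets i j \<lfloor>x * 2 ^ j\<rfloor> then ennreal (v i) else 0)"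
        by (rule sum_le_suminf) auto
      finally show "(if \<bar>x - a i\<bar> \<le> e i then ennreal (v i) else 0) \<le> (\<Sum>j. if meets i j \<lfloor>x * 2 ^ j\<rfloor> then ennreal (v i) else 0)" .
    qed auto
    also have "\<dots> = (\<Sum>j. b j \<lfloor>x * 2 ^ j\<rfloor>)" unfolding b_def by (rule suminf_ennreal_swap)
    finally show ?thesis .
  qed
  have covered: "\<exists>p. sel \<theta> p \<and> x \<in> D p" if x: "x \<in> A" and \<theta>: "0 < \<theta>" "\<theta> < G" for x \<theta>
  proof -
    define P where "P l = (\<Sum>j<l. b j \<lfloor>x * 2 ^ j\<rfloor>)" for l
    have "ennreal \<theta> < ennreal G" using \<theta> by (simp add: ennreal_less_iff)
    then have "ennreal \<theta> < (\<Sum>j. b j \<lfloor>x * 2 ^ j\<rfloor>)"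
      using branch_total[OF x] by (rule less_le_trans)
    then have "\<exists>l. ennreal \<theta> < P l"
      unfolding suminf_eq_SUP P_def less_SUP_iff by auto
    then have ex: "\<exists>l. ennreal \<theta> \<le> P l" by (auto intro: less_imp_le)
    define L where "L = (LEAST l. ennreal \<theta> \<le> P l)"
    have L: "ennreal \<theta> \<le> P L" unfolding L_def using ex by (rule LeastI_ex)
    have "L \<noteq> 0"
    proof
      assume "L = 0"
      then show False using L \<theta>(1) by (simp add: P_def)
    qed
    then obtain l where l: "L = Suc l" by (cases L) auto
    then have "P l < ennreal \<theta>"
      using not_less_Least[of l "\<lambda>l. ennreal \<theta> \<le> P l"] unfolding L_def[symmetric] by simp
    with L l have "sel \<theta> (l, \<lfloor>x * 2 ^ l\<rfloor>)"
      by (simp add: sel_def branch P_def)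
    moreover have "x \<in> D (l, \<lfloor>x * 2 ^ l\<rfloor>)" by (simp add: D_def)
    ultimately show ?thesis by blast
  qed
  \<comment> \<open>Coverings are indexed by natural numbers, dyadic intervals by level and position.\<close>
  define \<pi> where "\<pi> = from_nat_into (UNIV :: (nat \<times> int) set)"
  have \<pi>: "bij \<pi>" unfolding \<pi>_def
    by (rule bij_betw_from_nat_into) (auto simp: finite_prod)
  define R where "R = 2 * 4 powr s * M"
  have R: "R > 0" using M by (simp add: R_def)
  have sum_b: "(\<Sum>n. b (fst (\<pi> n)) (snd (\<pi> n)) * len (\<pi> n)) \<le> ennreal R"
  proof -
    have "(\<Sum>n. b (fst (\<pi> n)) (snd (\<pi> n)) * len (\<pi> n))
        = (\<Sum>n. \<Sum>i. (if meets i (fst (\<pi> n)) (snd (\<pi> n)) then ennreal (v i) else 0) * len (\<pi> n))"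
      unfolding b_def by (simp add: ennreal_suminf_multc)
    also have "\<dots> = (\<Sum>i. \<Sum>n. (if meets i (fst (\<pi> n)) (snd (\<pi> n)) then ennreal (v i) else 0) * len (\<pi> n))"
      by (rule suminf_ennreal_swap)
    also have "\<dots> \<le> (\<Sum>i. ennreal (2 * 4 powr s) * ennreal (v i * e i powr s))"
    proof (rule suminf_le)
      fix i
      define k1 where "k1 = \<lfloor>(a i - e i) * 2 ^ lev i\<rfloor>"
      define k2 where "k2 = \<lfloor>(a i + e i) * 2 ^ lev i\<rfloor>"
      define N where "N = inv \<pi> ` {(lev i, k1), (lev i, k2)}"
      have N: "finite N" "card N \<le> 2"
        unfolding N_def by (auto intro!: order.trans[OF card_image_le] simp: card_insert_if)
      have "(\<Sum>n. (if meets i (fst (\<pi> n)) (snd (\<pi> n)) then ennreal (v i) else 0) * len (\<pi> n))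
          = (\<Sum>n\<in>N. (if meets i (fst (\<pi> n)) (snd (\<pi> n)) then ennreal (v i) else 0) * len (\<pi> n))"
      proof (rule suminf_finite[OF N(1)])
        fix n assume n: "n \<notin> N"
        have "\<not> meets i (fst (\<pi> n)) (snd (\<pi> n))"
        proof
          assume "meets i (fst (\<pi> n)) (snd (\<pi> n))"
          then have "\<pi> n \<in> {(lev i, k1), (lev i, k2)}"
            by (cases "\<pi> n") (auto simp: meets_def k1_def k2_def)
          then have "inv \<pi> (\<pi> n) \<in> N" unfolding N_def by (rule imageI)
          then show False using n \<pi> by (simp add: bij_is_inj)
        qed
        then show "(if meets i (fst (\<pi> n)) (snd (\<pi> n)) then ennreal (v i) else 0) * len (\<pi> n) = 0" by simp
      qed
      also have "\<dots> \<le> (\<Sum>n\<in>N. ennreal (v i * (4 * e i) powr s))"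
      proof (rule sum_mono)
        fix n assume "n \<in> N"
        then have "fst (\<pi> n) = lev i" using \<pi> by (auto simp: N_def bij_is_surj surj_f_inv_f)
        then have "len (\<pi> n) \<le> ennreal ((4 * e i) powr s)"
          using lev(2)[of i] s by (auto simp: len_def intro!: ennreal_leI powr_mono2)
        then show "(if meets i (fst (\<pi> n)) (snd (\<pi> n)) then ennreal (v i) else 0) * len (\<pi> n) \<le> ennreal (v i * (4 * e i) powr s)"
          using v[of i] by (auto simp: ennreal_mult intro!: mult_left_mono)
      qed
      also have "\<dots> = of_nat (card N) * ennreal (v i * (4 * e i) powr s)" by simp
      also have "\<dots> \<le> 2 * ennreal (v i * (4 * e i) powr s)"
        using N(2) by (intro mult_right_mono) (metis of_nat_mono of_nat_numeral, simp)
      also have "\<dots> = ennreal (2 * 4 powr s) * ennreal (v i * e i powr s)"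
        using e(1)[of i] v[of i] by (simp add: powr_mult ennreal_mult[symmetric] algebra_simps flip: ennreal_numeral)
      finally show "(\<Sum>n. (if meets i (fst (\<pi> n)) (snd (\<pi> n)) then ennreal (v i) else 0) * len (\<pi> n))
          \<le> ennreal (2 * 4 powr s) * ennreal (v i * e i powr s)" .
    qed auto
    also have "\<dots> = ennreal (2 * 4 powr s) * (\<Sum>i. ennreal (v i * e i powr s))" by simp
    also have "\<dots> \<le> ennreal (2 * 4 powr s) * ennreal M" using total by (rule mult_left_mono) simp
    also have "\<dots> = ennreal R" using M by (simp add: R_def ennreal_mult)
    finally show ?thesis .
  qed
  define X where "X p = {\<theta>. 0 < \<theta> \<and> \<theta> < G \<and> sel \<theta> p}" for p
  have X_meas: "X p \<in> sets lborel" for p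
    unfolding X_def sel_def by (cases p) (simp; measurable)
  have X_le: "emeasure lborel (X p) \<le> b (fst p) (snd p)" for p
    using emeasure_threshold_le[of G "S (fst p) (snd p)" "b (fst p) (snd p)"]
    unfolding X_def sel_def by (simp add: case_prod_beta)
  have "(\<integral>\<^sup>+\<theta>. (\<Sum>n. len (\<pi> n) * indicator (X (\<pi> n)) \<theta>) \<partial>lborel)
      = (\<Sum>n. \<integral>\<^sup>+\<theta>. len (\<pi> n) * indicator (X (\<pi> n)) \<theta> \<partial>lborel)"
    using X_meas by (intro nn_integral_suminf) auto
  also have "\<dots> = (\<Sum>n. len (\<pi> n) * emeasure lborel (X (\<pi> n)))"
    using X_meas by (simp add: nn_integral_cmult_indicator)
  also have "\<dots> \<le> (\<Sum>n. b (fst (\<pi> n)) (snd (\<pi> n)) * len (\<pi> n))"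
    using X_le by (subst mult.commute, intro suminf_le mult_right_mono) auto
  also have "\<dots> \<le> ennreal R" by (rule sum_b)
  finally have integral_le: "(\<integral>\<^sup>+\<theta>. (\<Sum>n. len (\<pi> n) * indicator (X (\<pi> n)) \<theta>) \<partial>lborel) \<le> ennreal R" .
  \<comment> \<open>The factor 2 leaves room for a strict inequality, so that the average need not be attained.\<close>
  have "\<exists>\<theta>. 0 < \<theta> \<and> \<theta> < G \<and> (\<Sum>n. len (\<pi> n) * indicator (X (\<pi> n)) \<theta>) \<le> ennreal (2 * R / G)"
  proof (rule ccontr)
    assume contr: "\<not> ?thesis"
    have "ennreal (2 * R / G) * ennreal G = (\<integral>\<^sup>+\<theta>. ennreal (2 * R / G) * indicator {0<..<G} \<theta> \<partial>lborel)"
      using G by (simp add: nn_integral_cmult_indicator)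
    also have "\<dots> \<le> (\<integral>\<^sup>+\<theta>. (\<Sum>n. len (\<pi> n) * indicator (X (\<pi> n)) \<theta>) \<partial>lborel)"
      using contr by (intro nn_integral_mono) (auto simp: indicator_def not_le)
    also have "\<dots> \<le> ennreal R" by (rule integral_le)
    finally have "ennreal (2 * R) \<le> ennreal R"
      using G R by (simp add: ennreal_mult[symmetric])
    then show False using R by (simp add: ennreal_le_iff)
  qed
  then obtain \<theta> where \<theta>: "0 < \<theta>" "\<theta> < G"
    and \<theta>_le: "(\<Sum>n. len (\<pi> n) * indicator (X (\<pi> n)) \<theta>) \<le> ennreal (2 * R / G)" by blast
  define U where "U n = (if sel \<theta> (\<pi> n) then D (\<pi> n) else {})" for n
  have "hausdorff_content s (4 * \<delta>) A \<le> (\<Sum>n. diam_weight s (U n))"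
  proof (rule hausdorff_content_le)
    show "A \<subseteq> (\<Union>n. U n)"
    proof
      fix x assume "x \<in> A"
      then obtain p where p: "sel \<theta> p" "x \<in> D p" using covered \<theta> by blast
      have "\<pi> (inv \<pi> p) = p" using \<pi> by (simp add: bij_is_surj surj_f_inv_f)
      then have "x \<in> U (inv \<pi> p)" using p by (simp add: U_def)
      then show "x \<in> (\<Union>n. U n)" by blast
    qed
    show "bounded (U n)" for n using D_bounded by (simp add: U_def)
    have d_pos: "\<delta> > 0" using e[of 0] by linarith
    show "diameter (U n) \<le> 4 * \<delta>" for n
    proof (cases "sel \<theta> (\<pi> n)")
      case True
      obtain l k where lk: "\<pi> n = (l, k)" by (cases "\<pi> n")
      have "b l k \<noteq> 0" using True lk by (auto simp: sel_def)
      moreover have "b l k = 0" if "\<And>i. \<not> meets i l k" using that by (simp add: b_def)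
      ultimately obtain i where "meets i l k" by blast
      then have "(1/2) ^ l \<le> 4 * e i" using lev(2)[of i] by (simp add: meets_def)
      then show ?thesis using True lk D_diam[of l k] e(2)[of i] by (simp add: U_def)
    qed (use d_pos in \<open>simp add: U_def\<close>)
  qed
  also have "\<dots> \<le> (\<Sum>n. len (\<pi> n) * indicator (X (\<pi> n)) \<theta>)"
  proof (rule suminf_le)
    fix n
    show "diam_weight s (U n) \<le> len (\<pi> n) * indicator (X (\<pi> n)) \<theta>"
      using D_weight[of "\<pi> n"] \<theta> by (cases "sel \<theta> (\<pi> n)") (auto simp: U_def X_def diam_weight_def)
  qed auto
  also have "\<dots> \<le> ennreal (2 * R / G)" by (rule \<theta>_le)
  finally show ?thesis by (simp add: R_def mult.assoc)
qed

section \<open>Hausdorff measure and coverings by balls\<close>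

lemma hausdorff_content_antimono:
  assumes "\<delta> \<le> \<delta>'"
  shows "hausdorff_content s \<delta>' A \<le> hausdorff_content s \<delta> A"
  unfolding hausdorff_content_def using assms by (intro INF_superset_mono) (auto intro: order.trans)

lemma hausdorff_content_vec1_le:
  fixes A :: "(real ^ 1) set"
  assumes "s > 0"
  shows "hausdorff_content s \<delta> A \<le> hausdorff_content s \<delta> ((\<lambda>v. v $ 1) ` A)"
  unfolding hausdorff_content_def[of s \<delta> "(\<lambda>v. v $ 1) ` A"]
proof (rule INF_greatest)
  fix U :: "nat \<Rightarrow> real set"
  assume "U \<in> {U. (\<lambda>v. v $ 1) ` A \<subseteq> (\<Union>i. U i) \<and> (\<forall>i. bounded (U i) \<and> diameter (U i) \<le> \<delta>)}"
  then have U: "(\<lambda>v. v $ 1) ` A \<subseteq> (\<Union>i. U i)" "\<And>i. bounded (U i)" "\<And>i. diameter (U i) \<le> \<delta>" by auto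
  define V where "V i = (\<lambda>v :: real ^ 1. v $ 1) -` U i" for i
  have V_bounded: "bounded (V i)" for i
    using U(2)[of i] unfolding bounded_iff V_def by (auto simp: norm_vector_1)
  have V_diam: "diameter (V i) \<le> diameter (U i)" for i
  proof (rule diameter_le)
    show "V i \<noteq> {} \<or> 0 \<le> diameter (U i)" using diameter_ge_0[OF U(2)] by blast
    fix x y assume "x \<in> V i" "y \<in> V i"
    then show "norm (x - y) \<le> diameter (U i)"
      using diameter_bounded_bound[OF U(2), of "x $ 1" i "y $ 1"]
      by (simp add: V_def norm_vector_1 dist_norm)
  qed
  have "hausdorff_content s \<delta> A \<le> (\<Sum>i. diam_weight s (V i))"
  proof (rule hausdorff_content_le)
    show "A \<subseteq> (\<Union>i. V i)" using U(1) by (force simp: V_def)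
    show "bounded (V i)" "diameter (V i) \<le> \<delta>" for i
      using V_bounded V_diam U(3) by (auto intro: order.trans)
  qed
  also have "\<dots> \<le> (\<Sum>i. diam_weight s (U i))"
  proof (rule suminf_le)
    show "diam_weight s (V i) \<le> diam_weight s (U i)" for i
      using assms V_diam[of i] diameter_ge_0[OF V_bounded[of i]]
      by (auto simp: diam_weight_def V_def intro!: ennreal_leI powr_mono2)
  qed auto
  finally show "hausdorff_content s \<delta> A \<le> (\<Sum>i. diam_weight s (U i))" .
qed

text \<open>
  Covering sets of diameter 0 have to be fattened to balls of positive radius, since every box must
  carry positive weight in the fibre argument. Adding a summable amount to the weights \<open>d powr u\<close>
  and taking roots does this without a case distinction on \<open>u \<le> 1\<close>.
\<close>

lemma finite_hausdorff_measure_covers: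
  fixes X :: "'a::metric_space set"
  assumes u: "u > 0" and fin: "hausdorff_measure u X \<noteq> \<infinity>"
  obtains M where "M > 0"
    "\<And>\<delta>. \<delta> > 0 \<Longrightarrow> \<exists>a e. (\<forall>i. 0 < e i \<and> e i \<le> \<delta>) \<and> X \<subseteq> (\<Union>i. cball (a i) (e i)) \<and>
      (\<Sum>i::nat. ennreal (e i powr u)) \<le> ennreal M"
proof -
  obtain h where h: "hausdorff_measure u X = ennreal h" "h \<ge> 0"
    using fin by (cases "hausdorff_measure u X") auto
  show ?thesis
  proof (rule that[of "h + 2"])
    show "h + 2 > 0" using h by simp
    fix \<delta> :: real assume \<delta>: "\<delta> > 0"
    define \<delta>' where "\<delta>' = \<delta> * 2 powr (- 1 / u)"
    define \<eta> where "\<eta> = min 1 (\<delta> powr u / 2)"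
    have \<delta>'_pos: "\<delta>' > 0" using \<delta> by (simp add: \<delta>'_def)
    have "\<delta>' powr u = \<delta> powr u * (2 powr (- 1 / u)) powr u" by (simp only: \<delta>'_def powr_mult)
    then have "\<delta>' powr u = \<delta> powr u / 2" using u by (simp only: powr_powr) (simp add: powr_minus)
    note \<delta>' = \<delta>'_pos this
    have \<eta>: "\<eta> > 0" "\<eta> \<le> 1" "\<eta> \<le> \<delta> powr u / 2" using \<delta> by (auto simp: \<eta>_def)
    have "hausdorff_content u \<delta>' X \<le> hausdorff_measure u X"
      unfolding hausdorff_measure_def using \<delta>' by (intro SUP_upper) simp
    also have "\<dots> < ennreal (h + 1)" using h by (simp add: ennreal_less_iff)
    finally obtain U where U: "X \<subseteq> (\<Union>i. U i)" "\<And>i. bounded (U i)" "\<And>i. diameter (U i) \<le> \<delta>'"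
      and weight: "(\<Sum>i. diam_weight u (U i)) < ennreal (h + 1)"
      unfolding hausdorff_content_def INF_less_iff by auto
    define d where "d i = diameter (U i)" for i
    have d: "0 \<le> d i" "d i \<le> \<delta>'" for i using U(2,3) by (auto simp: d_def diameter_ge_0)
    define w where "w i = d i powr u + \<eta> * (1/2) ^ Suc i" for i
    define e where "e i = w i powr (1 / u)" for i
    have w_pos: "w i > 0" for i using \<eta> d by (simp add: w_def add_nonneg_pos)
    have e_pow: "e i powr u = w i" for i using w_pos[of i] u by (simp add: e_def powr_powr)
    have e_pos: "e i > 0" for i using w_pos[of i] by (simp add: e_def)
    have e_le: "e i \<le> \<delta>" for i
    proof -
      have "d i powr u \<le> \<delta>' powr u" using d[of i] u by (intro powr_mono2) auto
      moreover have "\<eta> * (1/2) ^ Suc i \<le> \<eta> * 1" using \<eta> by (intro mult_left_mono power_le_one) auto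
      ultimately have "w i \<le> \<delta> powr u" unfolding w_def using \<delta>' \<eta> by linarith
      then have "e i \<le> (\<delta> powr u) powr (1 / u)" unfolding e_def using w_pos[of i] u by (intro powr_mono2) auto
      then show ?thesis using \<delta> u by (simp add: powr_powr)
    qed
    have d_e: "d i \<le> e i" for i
    proof -
      have "(d i powr u) powr (1 / u) \<le> e i" unfolding e_def w_def using \<eta> u by (intro powr_mono2) auto
      then show ?thesis using d[of i] u by (simp add: powr_powr)
    qed
    define a where "a i = (SOME x. x \<in> U i)" for i
    have "U i \<subseteq> cball (a i) (e i)" for i
    proof
      fix x assume x: "x \<in> U i"
      then have "a i \<in> U i" unfolding a_def by (rule someI)
      then have "dist (a i) x \<le> d i" unfolding d_def using x U(2) by (intro diameter_bounded_bound)
      then show "x \<in> cball (a i) (e i)" using d_e[of i] by simp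
    qed
    then have cover: "X \<subseteq> (\<Union>i. cball (a i) (e i))" using U(1) by fastforce
    have "(\<Sum>i. ennreal (e i powr u)) = (\<Sum>i. ennreal (d i powr u) + ennreal (\<eta> * (1/2) ^ Suc i))"
      using \<eta> by (simp add: e_pow w_def)
    also have "\<dots> = (\<Sum>i. ennreal (d i powr u)) + (\<Sum>i. ennreal (\<eta> * (1/2) ^ Suc i))"
      by (rule suminf_add[symmetric]) auto
    also have "\<dots> \<le> ennreal (h + 1) + ennreal 1"
    proof (rule add_mono)
      have "(\<Sum>i. ennreal (d i powr u)) \<le> (\<Sum>i. diam_weight u (U i))"
        using u by (intro suminf_le) (auto simp: diam_weight_def d_def diameter_empty)
      then show "(\<Sum>i. ennreal (d i powr u)) \<le> ennreal (h + 1)" using weight by simp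
      have "(\<lambda>i. \<eta> * (1/2) ^ Suc i) sums (\<eta> * 1)"
        by (intro sums_mult power_half_series)
      then have "(\<Sum>i. ennreal (\<eta> * (1/2) ^ Suc i)) = ennreal \<eta>"
        using \<eta> by (intro suminf_ennreal_eq) auto
      then show "(\<Sum>i. ennreal (\<eta> * (1/2) ^ Suc i)) \<le> ennreal 1" using \<eta> by (simp add: ennreal_leI)
    qed
    also have "\<dots> = ennreal (h + 2)" using h(2) by (subst ennreal_plus[symmetric]) auto
    finally show "\<exists>a e. (\<forall>i. 0 < e i \<and> e i \<le> \<delta>) \<and> X \<subseteq> (\<Union>i. cball (a i) (e i)) \<and>
      (\<Sum>i::nat. ennreal (e i powr u)) \<le> ennreal (h + 2)"
      using e_pos e_le cover by blast
  qed
qed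

section \<open>Exact order sets and their fibres\<close>

definition denominators :: "(nat \<Rightarrow> real) \<Rightarrow> real ^ 'n \<Rightarrow> nat set" where
  "denominators \<psi> \<alpha> = {q. q > 0 \<and> (\<exists>p :: int ^ 'n. \<forall>i. \<bar>\<alpha> $ i - of_int (p $ i) / real q\<bar> < \<psi> q)}"

text \<open>Each denominator occurs with finitely many numerators only, so counting denominators suffices.\<close>

lemma W_iff_denominators:
  fixes \<alpha> :: "real ^ 'n"
  shows "\<alpha> \<in> W \<psi> \<longleftrightarrow> (\<forall>i. 0 \<le> \<alpha> $ i \<and> \<alpha> $ i \<le> 1) \<and> infinite (denominators \<psi> \<alpha>)"
proof -
  define S where "S = {(q :: nat, p :: int ^ 'n). q > 0 \<and> (MAX i. \<bar>\<alpha> $ i - of_int (p $ i) / of_nat q\<bar>) < \<psi> q}"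
  have S: "S = {(q, p). q > 0 \<and> (\<forall>i. \<bar>\<alpha> $ i - of_int (p $ i) / real q\<bar> < \<psi> q)}"
    unfolding S_def by (subst Max_less_iff) auto
  have img: "fst ` S = denominators \<psi> \<alpha>" unfolding S denominators_def by force
  have fibre: "finite (fst -` {q} \<inter> S)" for q
  proof (cases "q > 0")
    case True
    have "snd ` (fst -` {q} \<inter> S) \<subseteq> vec_lambda ` lattice_cube UNIV (\<lambda>i. real q * \<alpha> $ i) (real q * \<psi> q)"
    proof
      fix p assume "p \<in> snd ` (fst -` {q} \<inter> S)"
      then have p: "\<bar>\<alpha> $ i - of_int (p $ i) / real q\<bar> < \<psi> q" for i by (auto simp: S)
      have "\<bar>of_int (p $ i) - real q * \<alpha> $ i\<bar> \<le> real q * \<psi> q" for i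
      proof -
        have "real q * \<bar>\<alpha> $ i - of_int (p $ i) / real q\<bar> \<le> real q * \<psi> q"
          using p[of i] by (intro mult_left_mono) auto
        moreover have "real q * \<bar>\<alpha> $ i - of_int (p $ i) / real q\<bar> = \<bar>of_int (p $ i) - real q * \<alpha> $ i\<bar>"
          using abs_mult[of "real q" "\<alpha> $ i - of_int (p $ i) / real q"] True
          by (simp add: right_diff_distrib abs_minus_commute)
        ultimately show ?thesis by simp
      qed
      then have "(($) p) \<in> lattice_cube UNIV (\<lambda>i. real q * \<alpha> $ i) (real q * \<psi> q)"
        unfolding lattice_cube_def by (intro PiE_I) auto
      then have "vec_lambda (($) p) \<in> vec_lambda ` lattice_cube UNIV (\<lambda>i. real q * \<alpha> $ i) (real q * \<psi> q)"
        by (rule imageI)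
      then show "p \<in> vec_lambda ` lattice_cube UNIV (\<lambda>i. real q * \<alpha> $ i) (real q * \<psi> q)" by simp
    qed
    then have "finite (snd ` (fst -` {q} \<inter> S))"
      by (rule finite_subset) (intro finite_imageI finite_lattice_cube finite)
    then show ?thesis by (rule finite_imageD) (auto simp: inj_on_def)
  next
    case False
    then have "fst -` {q} \<inter> S = {}" by (auto simp: S)
    then show ?thesis by simp
  qed
  have "infinite S \<longleftrightarrow> infinite (fst ` S)"
  proof -
    have "finite S" if "finite (fst ` S)"
    proof (rule finite_subset)
      show "finite (fst -` (fst ` S) \<inter> S)" by (rule finite_finite_vimage_IntI[OF that fibre])
    qed blast
    then show ?thesis by blast
  qed
  moreover have "\<alpha> \<in> W \<psi> \<longleftrightarrow> (\<forall>i. 0 \<le> \<alpha> $ i \<and> \<alpha> $ i \<le> 1) \<and> infinite S"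
    by (simp only: W_def S_def mem_Collect_eq)
  ultimately show ?thesis by (simp only: img)
qed

lemma fibre_in_E:
  fixes v :: "real ^ 1" and y :: "'n::finite \<Rightarrow> real" and \<psi> :: "nat \<Rightarrow> real"
  assumes v: "v \<in> E \<psi>" and y: "\<forall>k\<in>UNIV - {j}. 0 \<le> y k \<and> y k \<le> 1"
    and approx: "infinite {q \<in> denominators \<psi> v. q > 0 \<and>
      (\<exists>p::'n \<Rightarrow> int. \<forall>k\<in>UNIV - {j}. \<bar>y k - of_int (p k) / real q\<bar> < \<psi> q)}"
  shows "(\<chi> k. if k = j then v $ 1 else y k) \<in> E \<psi>" (is "?\<alpha> \<in> _")
proof -
  have "infinite (denominators \<psi> ?\<alpha>)"
  proof (rule infinite_super[OF _ approx], safe)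
    fix q and p :: "'n \<Rightarrow> int"
    assume "q \<in> denominators \<psi> v" and p: "\<forall>k\<in>UNIV - {j}. \<bar>y k - of_int (p k) / real q\<bar> < \<psi> q"
    then obtain p1 :: "int ^ 1" where q: "q > 0" and p1: "\<bar>v $ 1 - of_int (p1 $ 1) / real q\<bar> < \<psi> q"
      by (auto simp: denominators_def)
    have "\<bar>?\<alpha> $ i - of_int ((\<chi> k. if k = j then p1 $ 1 else p k) $ i) / real q\<bar> < \<psi> q" for i
      using p p1 by simp
    then show "q \<in> denominators \<psi> ?\<alpha>" unfolding denominators_def using q by blast
  qed
  moreover have v01: "0 \<le> v $ 1" "v $ 1 \<le> 1" using v by (auto simp: E_def W_iff_denominators)
  ultimately have "?\<alpha> \<in> W \<psi>" using y by (auto simp: W_iff_denominators)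
  moreover have "?\<alpha> \<notin> W (\<lambda>q. c * \<psi> q)" if "c \<in> {0<..<1}" for c
  proof
    assume "?\<alpha> \<in> W (\<lambda>q. c * \<psi> q)"
    then have "infinite (denominators (\<lambda>q. c * \<psi> q) ?\<alpha>)" by (simp add: W_iff_denominators)
    moreover have "denominators (\<lambda>q. c * \<psi> q) ?\<alpha> \<subseteq> denominators (\<lambda>q. c * \<psi> q) v"
    proof
      fix q assume "q \<in> denominators (\<lambda>q. c * \<psi> q) ?\<alpha>"
      then obtain p :: "int ^ 'n" where q: "q > 0" and p: "\<bar>?\<alpha> $ i - of_int (p $ i) / real q\<bar> < c * \<psi> q" for i
        by (auto simp: denominators_def)
      have "\<forall>i. \<bar>v $ i - of_int ((vec (p $ j) :: int ^ 1) $ i) / real q\<bar> < c * \<psi> q"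
        using p[of j] by (simp add: forall_1)
      then show "q \<in> denominators (\<lambda>q. c * \<psi> q) v" unfolding denominators_def using q by blast
    qed
    ultimately have "infinite (denominators (\<lambda>q. c * \<psi> q) v)" by (rule infinite_super[rotated])
    then have "v \<in> W (\<lambda>q. c * \<psi> q)" using v01 by (simp add: W_iff_denominators forall_1)
    then show False using v that by (auto simp: E_def)
  qed
  ultimately show ?thesis by (auto simp: E_def)
qed

theorem mainTheorem2:
  fixes \<nu> :: real
  assumes "CARD('n::finite) \<ge> 3"
    and "\<nu> > 2"
    and "hausdorff_measure (2 / \<nu>) (E (psi_pow \<nu>) :: (real ^ 1) set) > 0"
  shows "hausdorff_measure ((real CARD('n) + 1) / \<nu>) (E (psi_pow \<nu>) :: (real ^ 'n) set) = \<infinity>"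
proof (rule ccontr)
  assume not_inf: "\<not> ?thesis"
  define j where "j = (undefined :: 'n)"
  define I where "I = UNIV - {j}"
  define s where "s = 2 / \<nu>"
  define t where "t = real (card I) / \<nu>"
  define u where "u = (real CARD('n) + 1) / \<nu>"
  define A where "A = (\<lambda>v. v $ 1) ` (E (psi_pow \<nu>) :: (real ^ 1) set)"
  have card_I: "card I = CARD('n) - 1" by (simp add: I_def card_Diff_singleton)
  have "card I > 0" using card_I assms(1) by linarith
  then have I: "finite I" "I \<noteq> {}" by (simp_all add: card_gt_0_iff)
  have nu: "\<nu> > 1" using assms(2) by simp
  have s: "s > 0" and u: "u > 0" using nu by (simp_all add: s_def u_def add_nonneg_pos)
  have st: "t + s = u"
    using card_I assms(1) by (simp add: s_def t_def u_def add_divide_distrib[symmetric] of_nat_diff)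
  obtain M where M: "M > 0" and covers: "\<And>\<delta>. \<delta> > 0 \<Longrightarrow> \<exists>(a :: nat \<Rightarrow> real ^ 'n) e.
      (\<forall>i. 0 < e i \<and> e i \<le> \<delta>) \<and> E (psi_pow \<nu>) \<subseteq> (\<Union>i. cball (a i) (e i)) \<and> (\<Sum>i. ennreal (e i powr u)) \<le> ennreal M"
    using finite_hausdorff_measure_covers[OF u not_inf[folded u_def]] by blast
  \<comment> \<open>A covering of the exact order set in dimension \<open>n\<close> of cost at most \<open>M\<close>, fine enough for the fibres to
    have weight at least \<open>G\<close>, projects to a weighted covering of the line of cost \<open>M / G\<close>.\<close>
  have small: "hausdorff_content s \<delta> (E (psi_pow \<nu>) :: (real ^ 1) set) \<le> ennreal \<epsilon>" if "\<delta> > 0" "\<epsilon> > 0" for \<delta> \<epsilon>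
  proof -
    define G where "G = 4 * 4 powr s * M / \<epsilon>"
    have G: "G > 0" using M that by (simp add: G_def)
    obtain \<delta>1 where \<delta>1: "\<delta>1 > 0" and fibre: 
      "\<And>(Q :: nat set) (a :: nat \<Rightarrow> 'n \<Rightarrow> real) e T. infinite Q \<Longrightarrow> (\<And>i. 0 < e i \<and> e i \<le> \<delta>1) \<Longrightarrow>
      (\<And>y. \<forall>k\<in>I. 0 \<le> y k \<and> y k \<le> 1 \<Longrightarrow>
        infinite {q \<in> Q. q > 0 \<and> (\<exists>p::'n \<Rightarrow> int. \<forall>k\<in>I. \<bar>y k - of_int (p k) / real q\<bar> < real q powr (- \<nu>))} \<Longrightarrow>
        \<exists>i\<in>T. \<forall>k\<in>I. \<bar>y k - a i k\<bar> \<le> e i) \<Longrightarrow>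
      ennreal G \<le> (\<Sum>i. if i \<in> T then ennreal (e i powr (real (card I) / \<nu>)) else 0)"
      using fibre_cover[OF I nu, of G] by blast
    define \<delta>2 where "\<delta>2 = min \<delta>1 (min (\<delta> / 4) (1/2))"
    have \<delta>2: "\<delta>2 > 0" "\<delta>2 \<le> \<delta>1" "4 * \<delta>2 \<le> \<delta>" "\<delta>2 \<le> 1/2" using \<delta>1 that by (auto simp: \<delta>2_def)
    obtain a :: "nat \<Rightarrow> real ^ 'n" and e where e: "\<And>i. 0 < e i" "\<And>i. e i \<le> \<delta>2"
      and cover: "E (psi_pow \<nu>) \<subseteq> (\<Union>i. cball (a i) (e i))" and total: "(\<Sum>i. ennreal (e i powr u)) \<le> ennreal M"
      using covers[OF \<delta>2(1)] by blast
    have "hausdorff_content s (4 * \<delta>2) A \<le> ennreal (4 * 4 powr s * M / G)"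
    proof (rule weighted_cover_content[OF s e \<delta>2(4) _ G M, where a = "\<lambda>i. a i $ j" and v = "\<lambda>i. e i powr t"])
      show "(\<Sum>i. ennreal (e i powr t * e i powr s)) \<le> ennreal M"
        using total by (simp add: powr_add[symmetric] st)
      fix x assume "x \<in> A"
      then obtain v :: "real ^ 1" where v: "v \<in> E (psi_pow \<nu>)" "x = v $ 1" by (auto simp: A_def)
      define T where "T = {i. \<bar>x - a i $ j\<bar> \<le> e i}"
      have "ennreal G \<le> (\<Sum>i. if i \<in> T then ennreal (e i powr (real (card I) / \<nu>)) else 0)"
      proof (rule fibre)
        show "infinite (denominators (psi_pow \<nu>) v)" using v(1) by (simp add: E_def W_iff_denominators)
        show "0 < e i \<and> e i \<le> \<delta>1" for i using e[of i] \<delta>2 by linarith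
        fix y assume "\<forall>k\<in>I. 0 \<le> y k \<and> y k \<le> 1"
          "infinite {q \<in> denominators (psi_pow \<nu>) v. q > 0 \<and>
            (\<exists>p::'n \<Rightarrow> int. \<forall>k\<in>I. \<bar>y k - of_int (p k) / real q\<bar> < real q powr (- \<nu>))}"
        then have "(\<chi> k. if k = j then v $ 1 else y k) \<in> E (psi_pow \<nu>)" (is "?\<alpha> \<in> _")
          unfolding I_def by (intro fibre_in_E[OF v(1)]) (simp_all add: psi_pow_def)
        then obtain i where i: "norm (?\<alpha> - a i) \<le> e i"
          using cover by (auto simp: dist_norm norm_minus_commute)
        have near: "\<bar>?\<alpha> $ k - a i $ k\<bar> \<le> e i" for k
          using component_le_norm_cart[of "?\<alpha> - a i" k] i by simp
        have "i \<in> T" using near[of j] v(2) by (simp add: T_def)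
        moreover have "\<forall>k\<in>I. \<bar>y k - a i $ k\<bar> \<le> e i"
        proof
          fix k assume "k \<in> I"
          then show "\<bar>y k - a i $ k\<bar> \<le> e i" using near[of k] by (simp add: I_def)
        qed
        ultimately show "\<exists>i\<in>T. \<forall>k\<in>I. \<bar>y k - a i $ k\<bar> \<le> e i" by blast
      qed
      then show "ennreal G \<le> (\<Sum>i. if \<bar>x - a i $ j\<bar> \<le> e i then ennreal (e i powr t) else 0)"
        unfolding T_def t_def mem_Collect_eq .
    qed auto
    also have "4 * 4 powr s * M / G = \<epsilon>" using M that by (simp add: G_def)
    finally have "hausdorff_content s (4 * \<delta>2) A \<le> ennreal \<epsilon>" .
    then show ?thesis
      using hausdorff_content_vec1_le[OF s] hausdorff_content_antimono[OF \<delta>2(3)] unfolding A_def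
      by (meson order.trans)
  qed
  have "hausdorff_content s \<delta> (E (psi_pow \<nu>) :: (real ^ 1) set) = 0" if "\<delta> > 0" for \<delta>
  proof -
    have "hausdorff_content s \<delta> (E (psi_pow \<nu>) :: (real ^ 1) set) \<le> 0"
      by (rule ennreal_le_epsilon) (use small[OF that] in simp)
    then show ?thesis by simp
  qed
  then have "hausdorff_measure s (E (psi_pow \<nu>) :: (real ^ 1) set) = 0"
    unfolding hausdorff_measure_def by simp
  then show False using assms(3) by (simp add: s_def)
qed

end
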